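(* Let $(U^n,\boldsymbol Q^n,\widehat U^n)\in W_h\times\boldsymbol V_h\times M_h$, $n\ge0$, satisfy the fully discrete HDG equations in the context. Then for $n\ge1$ $$\mathbb E^{n+1/2}=\mathbb E^{3/2},$$ where $$\mathbb E^{n+1/2}=\|\partial_tU^n\|^2+\tfrac12\Big(\|\boldsymbol Q^n\|^2+\|\boldsymbol Q^{n+1}\|^2+\|U^n-\widehat U^n\|_+^2+\|U^{n+1}-\widehat U^{n+1}\|_+^2+2(F(U^n),1)+2(F(U^{n+1}),1)\Big).$$
   Context: $\Omega\subset\mathbb R^2$ is a convex polygonal domain. $\mathscr T_h$ is a shape regular triangulation of $\overline\Omega$, $\mathcal E_h$ the set of faces (edges), $\Gamma_\partial=\mathcal E_h\cap\partial\Omega$, $\boldsymbol n$ the unit outward normal of $K$, $k\ge0$ an integer, and $W_h=\{w\in L^2(\Omega): w|_K\in\mathcal P_k(K)\ \forall K\}$, $\boldsymbol V_h=\{\boldsymbol v\in[L^2(\Omega)]^2:\boldsymbol v|_K\in[\mathcal P_k(K)]^2\ \forall K\}$, $M_h=\{\mu\in L^2(\mathcal E_h):\mu|_E\in\mathcal P_k(E)\ \forall E\}$. $(\cdot,\cdot)=\sum_K\int_K$, $\langle\phi,\psi\rangle=\sum_K\int_{\partial K}\phi\psi$, $\|\cdot\|$ is the $L^2(\Omega)$ norm, $\tau:\mathcal E_h\to\mathbb R^+$ is constant on each face, $\|\psi-\widehat\psi\|_+^2=\sum_K\|\tau^{1/2}(\psi-\widehat\psi)\|_{L^2(\partial K)}^2$.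 $\Delta t>0$ is the time step, $\partial_t\varphi^n=(\varphi^{n+1}-\varphi^n)/\Delta t$, $\partial_t^2\varphi^n=(\varphi^{n+1}-2\varphi^n+\varphi^{n-1})/(\Delta t)^2$, $\mathscr A\varphi^n=\frac12(\varphi^{n+1}+\varphi^{n-1})$. $F(s)=\frac14(1-s^2)^2$ and $\mathscr F(a,b)=\frac{F(a)-F(b)}{a-b}$ if $a\ne b$, $\mathscr F(a,a)=F'(a)$ (applied pointwise). Fully discrete equations: for all $w_h\in W_h$, $\boldsymbol v_h\in\boldsymbol V_h$, $\mu_1,\mu_2\in M_h$, $(\partial_t^2U^n,w_h)+(\mathscr A\boldsymbol Q^n,\nabla w_h)-\langle\mathscr A\widehat{\boldsymbol Q}^n\cdot\boldsymbol n,w_h\rangle+(\mathscr F(U^{n+1},U^{n-1}),w_h)=0$ for $n\ge1$; and for $n\ge0$: $(\boldsymbol Q^n,\boldsymbol v_h)+(U^n,\nabla\cdot\boldsymbol v_h)-\langle\widehat U^n,\boldsymbol v_h\cdot\boldsymbol n\rangle=0$; $\sum_K\langle\widehat{\boldsymbol Q}^n\cdot\boldsymbol n,\mu_1\rangle_{\partial K\setminus\partial\Omega}=0$; $\langle\widehat U^n,\mu_2\rangle_{\Gamma_\partial}=0$; with $\widehat{\boldsymbol Q}^n\cdot\boldsymbol n=\boldsymbol Q^n\cdot\boldsymbol n-\tau(U^n-\widehat U^n)$. *)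

theory Defs
  imports "HOL-Analysis.Analysis"
begin

definition convex_polygonal_domain :: "(real^2) set \<Rightarrow> bool" where
  "convex_polygonal_domain \<Omega> \<longleftrightarrow>
     open \<Omega> \<and> \<Omega> \<noteq> {} \<and> convex \<Omega> \<and> polytope (closure \<Omega>)"

text \<open>The library notion \<^const>\<open>triangulation\<close> already says that the cells are finitely many
  closed simplices and that two cells meet in a common (possibly empty) face.\<close>

definition triangulation_of :: "(real^2) set set \<Rightarrow> (real^2) set \<Rightarrow> bool" where
  "triangulation_of T \<Omega> \<longleftrightarrow>
     triangulation T \<and> (\<forall>K\<in>T. 2 simplex K) \<and> \<Union>T = closure \<Omega>"

text \<open>Shape regularity with constant \<open>\<sigma>\<close>: \<open>h\<^sub>K \<le> \<sigma> \<rho>\<^sub>K\<close>, where \<open>\<rho>\<^sub>K\<close> is the diameter of the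
  largest disc contained in \<open>K\<close>.\<close>

definition incircle_diameter :: "(real^2) set \<Rightarrow> real" where
  "incircle_diameter K = 2 * Sup {r. 0 \<le> r \<and> (\<exists>x. cball x r \<subseteq> K)}"

definition shape_regular :: "real \<Rightarrow> (real^2) set set \<Rightarrow> bool" where
  "shape_regular \<sigma> T \<longleftrightarrow> (\<forall>K\<in>T. diameter K \<le> \<sigma> * incircle_diameter K)"

definition mesh_edges :: "(real^2) set set \<Rightarrow> (real^2) set set" where
  "mesh_edges T = {E. \<exists>K\<in>T. E facet_of K}"

definition boundary_edges :: "(real^2) set \<Rightarrow> (real^2) set set \<Rightarrow> (real^2) set set" where
  "boundary_edges \<Omega> T = {E \<in> mesh_edges T. E \<subseteq> frontier \<Omega>}"

text \<open>The unit outward normal of \<open>K\<close> on its edge \<open>E\<close>. As \<open>E \<subseteq> K\<close>, the inequality used with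
  \<open>x, y \<in> E\<close> in both orders also makes \<open>\<nu>\<close> orthogonal to \<open>E\<close>.\<close>

definition outward_normal :: "(real^2) set \<Rightarrow> (real^2) set \<Rightarrow> real^2" where
  "outward_normal K E = (THE \<nu>. norm \<nu> = 1 \<and> (\<forall>x\<in>E. \<forall>y\<in>K. \<nu> \<bullet> (y - x) \<le> 0))"

text \<open>Arc length measure on a segment. The two possible orders of the end points give the same
  measure. It is completed so that, as for Lebesgue measure, functions may be changed on
  null sets.\<close>

definition edge_measure :: "(real^2) set \<Rightarrow> (real^2) measure" where
  "edge_measure E =
     (let (a, b) = (SOME (a, b). E = closed_segment a b)
      in completion (scale_measure (ennreal (dist a b))
           (distr (lebesgue_on {0..1}) borel (linepath a b))))"

definition square_integrable :: "'a measure \<Rightarrow> ('a \<Rightarrow> 'b::euclidean_space) \<Rightarrow> bool" where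
  "square_integrable M f \<longleftrightarrow>
     f \<in> borel_measurable M \<and> integrable M (\<lambda>x. (norm (f x))\<^sup>2)"

text \<open>Bivariate polynomials of total degree at most \<open>k\<close>, as functions on the plane. Their
  restrictions to an edge are exactly the polynomials of degree at most \<open>k\<close> in arc length.\<close>

definition poly_space :: "nat \<Rightarrow> (real^2 \<Rightarrow> real) set" where
  "poly_space k =
     {p. \<exists>c. \<forall>x. p x = (\<Sum>i\<le>k. \<Sum>j\<le>k - i. c i j * (x $ 1) ^ i * (x $ 2) ^ j)}"

text \<open>An element of an \<open>L\<^sup>2\<close> space is represented by an arbitrary function from its class, so being
  polynomial on a cell or an edge is required almost everywhere only.\<close>

definition W_space :: "(real^2) set \<Rightarrow> (real^2) set set \<Rightarrow> nat \<Rightarrow> (real^2 \<Rightarrow> real) set" where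
  "W_space \<Omega> T k = {w. square_integrable (lebesgue_on \<Omega>) w \<and>
     (\<forall>K\<in>T. \<exists>p\<in>poly_space k. AE x in lebesgue_on K. w x = p x)}"

definition V_space :: "(real^2) set \<Rightarrow> (real^2) set set \<Rightarrow> nat \<Rightarrow> (real^2 \<Rightarrow> real^2) set" where
  "V_space \<Omega> T k = {v. square_integrable (lebesgue_on \<Omega>) v \<and>
     (\<forall>K\<in>T. \<exists>p. (\<forall>i. (\<lambda>x. p x $ i) \<in> poly_space k) \<and> (AE x in lebesgue_on K. v x = p x))}"

definition M_space :: "(real^2) set set \<Rightarrow> nat \<Rightarrow> (real^2 \<Rightarrow> real) set" where
  "M_space T k = {\<mu>. \<forall>E\<in>mesh_edges T. square_integrable (edge_measure E) \<mu> \<and>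
     (\<exists>p\<in>poly_space k. AE x in edge_measure E. \<mu> x = p x)}"

text \<open>The polynomial that a piecewise polynomial class coincides with on the cell \<open>K\<close>. It is unique
  since \<open>K\<close> has nonempty interior. It provides the gradient, the divergence and the trace on
  \<open>\<partial>K\<close> (taken from \<open>K\<close>) of the restriction to \<open>K\<close>, none of which can be read off pointwise from an
  arbitrary representative of the class.\<close>

definition piece :: "(real^2) set \<Rightarrow> (real^2 \<Rightarrow> 'b::euclidean_space) \<Rightarrow> real^2 \<Rightarrow> 'b" where
  "piece K f = (SOME p. polynomial_function p \<and> (AE x in lebesgue_on K. f x = p x))"

definition grad :: "(real^2 \<Rightarrow> real) \<Rightarrow> real^2 \<Rightarrow> real^2" where
  "grad f x = (\<chi> i. frechet_derivative f (at x) (axis i 1))"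

definition divergence :: "(real^2 \<Rightarrow> real^2) \<Rightarrow> real^2 \<Rightarrow> real" where
  "divergence v x = (\<Sum>i\<in>UNIV. frechet_derivative v (at x) (axis i 1) $ i)"

text \<open>Integrands that involve the restriction to a cell depend on the cell \<open>K\<close>; those on the
  boundary depend on \<open>K\<close> and on its edge \<open>E\<close>.\<close>

definition vol_pair ::
  "(real^2) set set \<Rightarrow> ((real^2) set \<Rightarrow> real^2 \<Rightarrow> 'b::euclidean_space) \<Rightarrow>
   ((real^2) set \<Rightarrow> real^2 \<Rightarrow> 'b) \<Rightarrow> real" where
  "vol_pair T f g = (\<Sum>K\<in>T. LINT x|lebesgue_on K. f K x \<bullet> g K x)"

definition bd_pair ::
  "(real^2) set set \<Rightarrow> ((real^2) set \<Rightarrow> (real^2) set \<Rightarrow> real^2 \<Rightarrow> real) \<Rightarrow>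
   ((real^2) set \<Rightarrow> (real^2) set \<Rightarrow> real^2 \<Rightarrow> real) \<Rightarrow> real" where
  "bd_pair T \<phi> \<psi> =
     (\<Sum>K\<in>T. \<Sum>E | E facet_of K. LINT x|edge_measure E. \<phi> K E x * \<psi> K E x)"

definition interior_bd_pair ::
  "(real^2) set \<Rightarrow> (real^2) set set \<Rightarrow>
   ((real^2) set \<Rightarrow> (real^2) set \<Rightarrow> real^2 \<Rightarrow> real) \<Rightarrow>
   ((real^2) set \<Rightarrow> (real^2) set \<Rightarrow> real^2 \<Rightarrow> real) \<Rightarrow> real" where
  "interior_bd_pair \<Omega> T \<phi> \<psi> =
     (\<Sum>K\<in>T. \<Sum>E | E facet_of K \<and> \<not> E \<subseteq> frontier \<Omega>.
        LINT x|edge_measure E. \<phi> K E x * \<psi> K E x)"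

definition outer_bd_pair ::
  "(real^2) set \<Rightarrow> (real^2) set set \<Rightarrow> (real^2 \<Rightarrow> real) \<Rightarrow> (real^2 \<Rightarrow> real) \<Rightarrow> real" where
  "outer_bd_pair \<Omega> T \<phi> \<psi> =
     (\<Sum>E\<in>boundary_edges \<Omega> T. LINT x|edge_measure E. \<phi> x * \<psi> x)"

definition l2norm :: "'a measure \<Rightarrow> ('a \<Rightarrow> 'b::euclidean_space) \<Rightarrow> real" where
  "l2norm M f = sqrt (LINT x|M. (norm (f x))\<^sup>2)"

text \<open>\<open>\<tau>\<close> is constant on each edge, hence a function of the edge.\<close>

definition plus_norm ::
  "(real^2) set set \<Rightarrow> ((real^2) set \<Rightarrow> real) \<Rightarrow> (real^2 \<Rightarrow> real) \<Rightarrow> (real^2 \<Rightarrow> real) \<Rightarrow> real" where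
  "plus_norm T \<tau> \<psi> \<psi>h =
     sqrt (\<Sum>K\<in>T. \<Sum>E | E facet_of K.
       (l2norm (edge_measure E) (\<lambda>x. sqrt (\<tau> E) * (piece K \<psi> x - \<psi>h x)))\<^sup>2)"

definition dt :: "real \<Rightarrow> (nat \<Rightarrow> 'v::real_vector) \<Rightarrow> nat \<Rightarrow> 'v" where
  "dt \<Delta> \<phi> n = (\<phi> (n + 1) - \<phi> n) /\<^sub>R \<Delta>"

text \<open>\<open>dtt\<close> and \<open>avg\<close> are only meant for \<open>n \<ge> 1\<close>: at \<open>n = 0\<close> the index \<open>n - 1\<close> is truncated.\<close>

definition dtt :: "real \<Rightarrow> (nat \<Rightarrow> 'v::real_vector) \<Rightarrow> nat \<Rightarrow> 'v" where
  "dtt \<Delta> \<phi> n = (\<phi> (n + 1) - 2 *\<^sub>R \<phi> n + \<phi> (n - 1)) /\<^sub>R \<Delta>\<^sup>2"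

definition avg :: "(nat \<Rightarrow> 'v::real_vector) \<Rightarrow> nat \<Rightarrow> 'v" where
  "avg \<phi> n = (1/2) *\<^sub>R (\<phi> (n + 1) + \<phi> (n - 1))"

definition F_pot :: "real \<Rightarrow> real" where
  "F_pot s = 1/4 * (1 - s\<^sup>2)\<^sup>2"

definition F_quot :: "real \<Rightarrow> real \<Rightarrow> real" where
  "F_quot a b = (if a \<noteq> b then (F_pot a - F_pot b) / (a - b) else deriv F_pot a)"

definition num_flux ::
  "((real^2) set \<Rightarrow> real) \<Rightarrow> (real^2 \<Rightarrow> real) \<Rightarrow> (real^2 \<Rightarrow> real^2) \<Rightarrow> (real^2 \<Rightarrow> real) \<Rightarrow>
   (real^2) set \<Rightarrow> (real^2) set \<Rightarrow> real^2 \<Rightarrow> real" where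
  "num_flux \<tau> u q uh K E x =
     piece K q x \<bullet> outward_normal K E - \<tau> E * (piece K u x - uh x)"

definition hdg_scheme ::
  "(real^2) set \<Rightarrow> (real^2) set set \<Rightarrow> nat \<Rightarrow> ((real^2) set \<Rightarrow> real) \<Rightarrow> real \<Rightarrow>
   (nat \<Rightarrow> real^2 \<Rightarrow> real) \<Rightarrow> (nat \<Rightarrow> real^2 \<Rightarrow> real^2) \<Rightarrow> (nat \<Rightarrow> real^2 \<Rightarrow> real) \<Rightarrow> bool" where
  "hdg_scheme \<Omega> T k \<tau> \<Delta> U Q Uh \<longleftrightarrow>
     (\<forall>n\<ge>1. \<forall>w\<in>W_space \<Omega> T k.
        vol_pair T (\<lambda>K x. dtt \<Delta> (\<lambda>m. U m x) n) (\<lambda>K. w)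
        + vol_pair T (\<lambda>K x. avg (\<lambda>m. Q m x) n) (\<lambda>K. grad (piece K w))
        - bd_pair T (\<lambda>K E x. avg (\<lambda>m. num_flux \<tau> (U m) (Q m) (Uh m) K E x) n)
            (\<lambda>K E. piece K w)
        + vol_pair T (\<lambda>K x. F_quot (U (n + 1) x) (U (n - 1) x)) (\<lambda>K. w) = 0) \<and>
     (\<forall>n. \<forall>v\<in>V_space \<Omega> T k.
        vol_pair T (\<lambda>K. Q n) (\<lambda>K. v)
        + vol_pair T (\<lambda>K. U n) (\<lambda>K. divergence (piece K v))
        - bd_pair T (\<lambda>K E. Uh n) (\<lambda>K E x. piece K v x \<bullet> outward_normal K E) = 0) \<and>
     (\<forall>n. \<forall>\<mu>\<in>M_space T k.
        interior_bd_pair \<Omega> T (num_flux \<tau> (U n) (Q n) (Uh n)) (\<lambda>K E. \<mu>) = 0) \<and>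
     (\<forall>n. \<forall>\<mu>\<in>M_space T k. outer_bd_pair \<Omega> T (Uh n) \<mu> = 0)"

text \<open>\<open>energy \<dots> n\<close> is the energy at the time level \<open>n + 1/2\<close>.\<close>

definition energy ::
  "(real^2) set \<Rightarrow> (real^2) set set \<Rightarrow> ((real^2) set \<Rightarrow> real) \<Rightarrow> real \<Rightarrow>
   (nat \<Rightarrow> real^2 \<Rightarrow> real) \<Rightarrow> (nat \<Rightarrow> real^2 \<Rightarrow> real^2) \<Rightarrow> (nat \<Rightarrow> real^2 \<Rightarrow> real) \<Rightarrow> nat \<Rightarrow> real" where
  "energy \<Omega> T \<tau> \<Delta> U Q Uh n =
     (l2norm (lebesgue_on \<Omega>) (\<lambda>x. dt \<Delta> (\<lambda>m. U m x) n))\<^sup>2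
     + 1/2 * ((l2norm (lebesgue_on \<Omega>) (Q n))\<^sup>2 + (l2norm (lebesgue_on \<Omega>) (Q (n + 1)))\<^sup>2
        + (plus_norm T \<tau> (U n) (Uh n))\<^sup>2 + (plus_norm T \<tau> (U (n + 1)) (Uh (n + 1)))\<^sup>2
        + 2 * vol_pair T (\<lambda>K x. F_pot (U n x)) (\<lambda>K x. 1)
        + 2 * vol_pair T (\<lambda>K x. F_pot (U (n + 1) x)) (\<lambda>K x. 1))"

end

theory Submission
  imports Defs
begin

text \<open>
  Conservation of the energy follows from testing. In the wave equation at the time level
  \<open>n\<close> one takes \<open>w = U\<^sup>n\<^sup>+\<^sup>1 - U\<^sup>n\<^sup>-\<^sup>1\<close>. Writing \<open>w\<close> as the sum of the two consecutive
  increments turns the second difference quotient into the difference of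
  \<open>\<parallel>\<partial>\<^sub>tU\<parallel>\<^sup>2\<close> at two levels, and \<open>w\<close> is exactly the denominator of the quotient
  \<open>\<F>(U\<^sup>n\<^sup>+\<^sup>1, U\<^sup>n\<^sup>-\<^sup>1)\<close>, so that the nonlinear term becomes the difference of the potential
  energies (lemmas \<open>kinetic_balance\<close> and \<open>potential_balance\<close>).

  The two flux terms remain. The second equation of the scheme, at the levels \<open>n + 1\<close> and \<open>n - 1\<close>,
  is tested with the average \<open>v\<close> of \<open>Q\<^sup>n\<^sup>+\<^sup>1\<close> and \<open>Q\<^sup>n\<^sup>-\<^sup>1\<close>, and the two instances are subtracted: the
  mass term is half the difference of \<open>\<parallel>Q\<parallel>\<^sup>2\<close>, and the divergence term is turned into the
  gradient term of the wave equation by Green's formula on each triangle (lemma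
  \<open>discrete_green\<close>). What is left lives on the edges. Expanding the numerical flux there produces
  half the difference of \<open>\<parallel>U - Uh\<parallel>\<^sub>+\<^sup>2\<close>, together with the pairing of the averaged flux and
  \<open>Uh\<^sup>n\<^sup>+\<^sup>1 - Uh\<^sup>n\<^sup>-\<^sup>1\<close> (lemma \<open>edge_balance\<close>). This pairing vanishes: on interior edges by the
  continuity equation of the flux, and on boundary edges because the boundary equation,
  tested with \<open>Uh\<close> itself, forces \<open>Uh = 0\<close> almost everywhere (lemma \<open>avg_flux_Uh_diff\<close>).

  Three points carry the analytic weight. Green's formula is
  reduced to an integral over the unit triangle, where it is Fubini's theorem and the fundamental
  theorem of calculus in one direction; the affine map back to the cell and the two independent
  side directions give all directions. The outward normal times the length of an edge is the
  edge vector turned by a right angle, which identifies the boundary terms. Finally, elements of the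
  discrete spaces are only classes of functions: everything that is integrated coincides almost
  everywhere with a continuous function on the cell or edge at hand, and this property
  (\<open>essentially_continuous\<close>) gives measurability and integrability throughout.
\<close>

section \<open>Integrals over triangles\<close>

text \<open>The change of variables for vector valued integrands, applied to vectors with one component.\<close>

lemma integral_linear_image:
  fixes f :: "real^'m::{finite,wellorder} \<Rightarrow> real" and g :: "real^'m::_ \<Rightarrow> real^'m::_"
  assumes "linear g" and "(\<lambda>x. f (g x)) absolutely_integrable_on S"
  shows "integral (g ` S) f = \<bar>det (matrix g)\<bar> * integral S (\<lambda>x. f (g x))"
proof -
  let ?F = "\<lambda>x. vec (f x) :: real^1"
  have ai: "(?F \<circ> g) absolutely_integrable_on S"
    using assms(2) by (simp add: absolutely_integrable_on_1_iff o_def)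
  have "integral (g ` S) ?F = \<bar>det (matrix g)\<bar> *\<^sub>R integral S (?F \<circ> g)"
    using integral_change_of_variables_linear[OF assms(1)] ai by blast
  then show ?thesis
    by (simp add: integral_on_1_eq o_def vec_eq_iff)
qed

lemma continuous_on_vector_2 [continuous_intros]:
  fixes f g :: "'a::topological_space \<Rightarrow> real"
  assumes "continuous_on S f" "continuous_on S g"
  shows "continuous_on S (\<lambda>x. vector [f x, g x] :: real^2)"
proof -
  have "vector [f x, g x] = f x *\<^sub>R axis 1 1 + g x *\<^sub>R (axis 2 1 :: real^2)" for x
    by (simp add: vec_eq_iff forall_2 axis_def)
  then show ?thesis using assms by (simp add: continuous_intros)
qed

lemma borel_measurable_vector_2:
  "(\<lambda>(s,t). vector [s,t] :: real^2) \<in> borel_measurable (lborel :: (real\<times>real) measure)"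
proof -
  have "continuous_on UNIV (\<lambda>(s::real,t::real). vector [s,t] :: real^2)"
    unfolding case_prod_beta by (intro continuous_intros)
  then show ?thesis by (simp add: borel_measurable_continuous_onI)
qed

text \<open>Fubini's theorem concerns \<open>real \<times> real\<close>, while the cells live in \<open>real^2\<close>. Both
  Lebesgue measures give a box the product of its side lengths, so the obvious bijection
  carries one to the other.\<close>

lemma distr_lborel_vector_2:
  "distr (lborel :: (real\<times>real) measure) borel (\<lambda>(s,t). vector [s,t] :: real^2) = lborel"
proof (rule lborel_eqI[symmetric])
  note meas = borel_measurable_vector_2
  fix l u :: "real^2" assume lu: "\<And>b. b \<in> Basis \<Longrightarrow> l \<bullet> b \<le> u \<bullet> b"
  have le: "l $ i \<le> u $ i" for i
    using lu[of "axis i 1"] by (simp add: inner_axis axis_in_Basis_iff)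
  have pre: "(\<lambda>(s,t). vector [s,t] :: real^2) -` box l u = box (l$1) (u$1) \<times> box (l$2) (u$2)"
    by (auto simp: mem_box_cart forall_2)
  have B: "(Basis :: (real^2) set) = {axis 1 1, axis 2 1}"
    by (auto simp: Basis_vec_def UNIV_2)
  have "emeasure (distr (lborel :: (real\<times>real) measure) borel (\<lambda>(s,t). vector [s,t] :: real^2)) (box
      l u)
     = emeasure (lborel \<Otimes>\<^sub>M lborel) (box (l$1) (u$1) \<times> box (l$2) (u$2))"
    by (subst emeasure_distr[OF meas]) (simp_all add: pre lborel_prod)
  also have "\<dots> = ennreal ((u$1-l$1) * (u$2-l$2))"
    using le by (simp add: lborel.emeasure_pair_measure_Times ennreal_mult)
  also have "(u$1-l$1) * (u$2-l$2) = (\<Prod>b\<in>Basis. (u - l) \<bullet> b)"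
    unfolding B by (subst prod.insert) (auto simp: inner_axis axis_eq_axis)
  finally show "emeasure (distr (lborel :: (real\<times>real) measure) borel (\<lambda>(s,t). vector [s,t] ::
      real^2)) (box l u)
      = ennreal (\<Prod>b\<in>Basis. (u - l) \<bullet> b)" .
qed simp

definition unit_triangle :: "(real^2) set" where
  "unit_triangle = {x. 0 \<le> x$1 \<and> 0 \<le> x$2 \<and> x$1 + x$2 \<le> 1}"

lemma compact_unit_triangle: "compact unit_triangle"
proof -
  have "unit_triangle \<subseteq> cbox 0 1"
    unfolding unit_triangle_def mem_box_cart subset_eq by (auto simp: forall_2)
  moreover have "closed unit_triangle"
    unfolding unit_triangle_def
    by (intro closed_Collect_conj closed_Collect_le continuous_intros)
  ultimately show ?thesis
    using bounded_cbox bounded_subset compact_eq_bounded_closed by blast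
qed

lemma compact_absolutely_integrable:
  fixes f :: "'a::euclidean_space \<Rightarrow> 'b::euclidean_space"
  assumes "compact S" "continuous_on S f"
  shows "f absolutely_integrable_on S"
  using borel_integrable_compact[OF assms] unfolding set_integrable_def
  using integrable_completion borel_measurable_integrable by blast

lemma compact_integral_eq_lborel:
  fixes f :: "'a::euclidean_space \<Rightarrow> 'b::euclidean_space"
  assumes "compact S" "continuous_on S f"
  shows "integral S f = (LINT x|lborel. indicator S x *\<^sub>R f x)"
proof -
  have "integral S f = (LINT x|lebesgue. indicator S x *\<^sub>R f x)"
    using set_lebesgue_integral_eq_integral(2)[OF compact_absolutely_integrable[OF assms]]
    by (simp add: set_lebesgue_integral_def)
  also have "\<dots> = (LINT x|lborel. indicator S x *\<^sub>R f x)"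
    by (rule integral_completion) (use borel_integrable_compact[OF assms] in auto)
  finally show ?thesis .
qed

text \<open>Together with \<open>integral_linear_image\<close> this gives the affine change of variables; it
  reduces to the translation invariance of Lebesgue measure.\<close>

lemma compact_integral_translation:
  fixes f :: "'a::euclidean_space \<Rightarrow> 'b::euclidean_space"
  assumes "compact S" "continuous_on ((+) a ` S) f"
  shows "integral ((+) a ` S) f = integral S (\<lambda>x. f (a + x))"
proof -
  have c: "compact ((+) a ` S)" "continuous_on S (\<lambda>x. f (a + x))"
    using assms(1) compact_translation
    by (auto intro!: continuous_on_compose2[OF assms(2), of S "\<lambda>x. a + x"] continuous_intros)
  have "integral ((+) a ` S) f = (LINT x|lborel. indicator ((+) a ` S) x *\<^sub>R f x)"
    using compact_integral_eq_lborel assms(2) c(1) by blast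
  also have "\<dots> = (LINT x|lborel. indicator ((+) a ` S) (a + x) *\<^sub>R f (a + x))"
    by (subst lborel_distr_plus[symmetric, of a], subst integral_distr)
      (use borel_integrable_compact[OF c(1) assms(2)] in auto)
  also have "\<dots> = (LINT x|lborel. indicator S x *\<^sub>R f (a + x))"
    by (intro Bochner_Integration.integral_cong) (auto simp: indicator_def image_iff)
  also have "\<dots> = integral S (\<lambda>x. f (a + x))"
    by (rule compact_integral_eq_lborel[symmetric]) (use assms c in auto)
  finally show ?thesis .
qed

text \<open>The only place where a derivative is integrated: on each horizontal line the triangle is the
  interval \<open>[0, 1 - t]\<close>, on which the fundamental theorem of calculus applies.\<close>

lemma integral_unit_triangle_partial:
  fixes f f1 :: "real^2 \<Rightarrow> real"
  assumes d: "\<And>s t. ((\<lambda>s. f (vector [s,t])) has_real_derivative f1 (vector [s,t])) (at s)"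
    and c: "continuous_on UNIV f1" and c0: "continuous_on UNIV f"
  shows "integral unit_triangle f1 = integral {0..1} (\<lambda>t. f (vector [1-t,t]) - f (vector [0,t]))"
proof -
  let ?v = "\<lambda>s t. vector [s,t] :: real^2"
  note meas = borel_measurable_vector_2
  have c': "continuous_on unit_triangle f1"
    using c continuous_on_subset by blast
  let ?h = "\<lambda>x. indicator unit_triangle x *\<^sub>R f1 x"
  have int: "integrable lborel ?h"
    by (rule borel_integrable_compact[OF compact_unit_triangle c'])
  have "integral unit_triangle f1 = (LINT x|lborel. ?h x)"
    using compact_integral_eq_lborel[OF compact_unit_triangle c'] .
  also have "\<dots> = (LINT z|(lborel \<Otimes>\<^sub>M lborel). ?h (case z of (s,t) \<Rightarrow> ?v s t))"
    unfolding lborel_prod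
    by (subst distr_lborel_vector_2[symmetric], subst integral_distr[OF meas]) (use int in auto)
  also have "\<dots> = (LINT t|lborel. LINT s|lborel. ?h (?v s t))"
  proof -
    have "integrable (distr (lborel :: (real\<times>real) measure) borel (\<lambda>(s,t). ?v s t)) ?h"
      using int unfolding distr_lborel_vector_2 .
    then have "integrable (lborel \<Otimes>\<^sub>M lborel) (\<lambda>(s,t). ?h (?v s t))"
      unfolding lborel_prod by (subst (asm) integrable_distr_eq[OF meas]) (use int in \<open>auto simp:
          case_prod_unfold\<close>)
    from lborel_pair.integral_snd[OF this] show ?thesis by (simp add: case_prod_unfold)
  qed
  also have "\<dots> = (LINT t|lborel. indicator {0..1} t *\<^sub>R (f (?v (1-t) t) - f (?v 0 t)))"
  proof (rule Bochner_Integration.integral_cong[OF refl])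
    fix t :: real
    show "(LINT s|lborel. ?h (?v s t)) = indicator {0..1} t *\<^sub>R (f (?v (1-t) t) - f (?v 0 t))"
    proof (cases "t \<in> {0..1}")
      case True
      have "(LINT s|lborel. ?h (?v s t)) = (LINT s|lborel. indicator {0..1-t} s *\<^sub>R f1 (?v s t))"
        using True by (intro Bochner_Integration.integral_cong)
            (auto simp: unit_triangle_def indicator_def)
      also have "\<dots> = f (?v (1-t) t) - f (?v 0 t)"
      proof (rule integral_FTC_Icc[where F = "\<lambda>s. f (?v s t)"])
        have "continuous_on {0..1-t} (\<lambda>s. ?v s t)"
          by (intro continuous_intros)
        then show "continuous_on {0..1-t} (\<lambda>s. f1 (?v s t))"
          by (rule continuous_on_compose2[OF c]) auto
      qed (use True d in \<open>auto simp: has_real_derivative_iff_has_vector_derivative[symmetric] intro: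
          has_field_derivative_at_within\<close>)
      finally show ?thesis using True by simp
    next
      case False
      then have "?h (?v s t) = 0" for s by (auto simp: unit_triangle_def indicator_def)
      then have "(LINT s|lborel. ?h (?v s t)) = (LINT s|(lborel :: real measure). 0)"
        by (simp only:)
      then show ?thesis using False by simp
    qed
  qed
  also have "\<dots> = integral {0..1} (\<lambda>t. f (?v (1-t) t) - f (?v 0 t))"
  proof -
    have v: "continuous_on {0..1} (\<lambda>t. ?v (1-t) t)" "continuous_on {0..1} (\<lambda>t. ?v 0 t)"
      by (intro continuous_intros)+
    have "continuous_on {0..1} (\<lambda>t. f (?v (1-t) t) - f (?v 0 t))"
      by (intro continuous_on_diff
          continuous_on_compose2[OF c0 v(1)] continuous_on_compose2[OF c0 v(2)]) auto
    from compact_integral_eq_lborel[OF _ this] show ?thesis by simp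
  qed
  finally show ?thesis .
qed

text \<open>The unit triangle is mapped onto the given one by \<open>x \<mapsto> a + x\<^sub>1 (b - a) + x\<^sub>2 (c - a)\<close>, whose linear
  part has the determinant in front of the integral.\<close>

lemma integral_triangle_unit_triangle:
  fixes a b c :: "real^2" and f :: "real^2 \<Rightarrow> real"
  assumes "continuous_on UNIV f"
  shows "integral (convex hull {a,b,c}) f =
    \<bar>(b-a)$1 * (c-a)$2 - (b-a)$2 * (c-a)$1\<bar> *
     integral unit_triangle (\<lambda>x. f (a + (x$1 *\<^sub>R (b-a) + x$2 *\<^sub>R (c-a))))"
proof -
  define g :: "real^2 \<Rightarrow> real^2" where "g x = x$1 *\<^sub>R (b-a) + x$2 *\<^sub>R (c-a)" for x
  have lin: "linear g"
    by (rule linearI) (simp_all add: g_def algebra_simps)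
  have det: "det (matrix g) = (b-a)$1 * (c-a)$2 - (b-a)$2 * (c-a)$1"
    by (simp add: det_2 matrix_def g_def axis_def algebra_simps)
  have cg: "continuous_on UNIV g"
    using lin linear_continuous_on linear_conv_bounded_linear by blast
  have img: "convex hull {a,b,c} = (\<lambda>x. a + x) ` (g ` unit_triangle)"
  proof (intro equalityI subsetI)
    fix x assume "x \<in> convex hull {a,b,c}"
    then obtain u v w where *: "0 \<le> u" "0 \<le> v" "0 \<le> w" "u + v + w = 1"
      "x = u *\<^sub>R a + v *\<^sub>R b + w *\<^sub>R c"
      unfolding convex_hull_3 by auto
    have "x = a + g (vector [v,w])"
    proof -
      have u: "u = 1 - v - w" using * by simp
      show ?thesis unfolding *(5) g_def u by (simp add: algebra_simps)
    qed
    then show "x \<in> (\<lambda>x. a + x) ` (g ` unit_triangle)"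
      using * by (auto simp: unit_triangle_def intro!: imageI)
  next
    fix x assume "x \<in> (\<lambda>x. a + x) ` (g ` unit_triangle)"
    then obtain y where y: "y \<in> unit_triangle" "x = a + g y" by auto
    show "x \<in> convex hull {a,b,c}"
      unfolding convex_hull_3 mem_Collect_eq
      by (intro exI[of _ "1 - y$1 - y$2"] exI[of _ "y$1"] exI[of _ "y$2"])
        (use y in \<open>auto simp: unit_triangle_def g_def algebra_simps\<close>)
  qed
  have "integral (convex hull {a,b,c}) f = integral (g ` unit_triangle) (\<lambda>x. f (a + x))"
    unfolding img
    by (intro compact_integral_translation compact_continuous_image compact_unit_triangle
        continuous_on_subset[OF cg] continuous_on_subset[OF assms]) auto
  also have "\<dots> = \<bar>det (matrix g)\<bar> * integral unit_triangle (\<lambda>x. f (a + g x))"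
    by (intro integral_linear_image lin compact_absolutely_integrable compact_unit_triangle
        continuous_on_compose2[OF assms] continuous_intros continuous_on_subset[OF cg]) auto
  finally show ?thesis by (simp add: det g_def)
qed

text \<open>The determinant of two plane vectors. For the sides \<open>b - a\<close> and \<open>c - a\<close> of a triangle it is
  twice the signed area, and it is positive when \<open>a, b, c\<close> run counterclockwise.\<close>

definition cross2 :: "real^2 \<Rightarrow> real^2 \<Rightarrow> real" where
  "cross2 u v = u$1 * v$2 - u$2 * v$1"

definition segment_mean :: "real^2 \<Rightarrow> real^2 \<Rightarrow> (real^2 \<Rightarrow> real) \<Rightarrow> real" where
  "segment_mean a b f = integral {0..1} (\<lambda>t. f (linepath a b t))"

lemma continuous_on_linepath_compose:
  assumes "continuous_on UNIV f"
  shows "continuous_on S (\<lambda>t. f (linepath a b t))"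
  by (rule continuous_on_compose2[OF assms continuous_on_linepath]) auto

text \<open>Reversing a segment is the substitution \<open>t \<mapsto> 1 - t\<close>. This is why an edge needs no orientation.\<close>

lemma segment_mean_commute: "segment_mean a b f = segment_mean b a f"
proof -
  have "((\<lambda>t. f (linepath b a t)) has_integral i) {0..1}"
    if "((\<lambda>t. f (linepath a b t)) has_integral i) {0..1}" for a b i
  proof -
    have "(\<lambda>x. (1 - x)) ` {0..1} = {0..1::real}"
      by (auto simp: image_iff intro!: bexI[of _ "1 - _"])
    then show ?thesis
      using has_integral_affinity01[OF that, of "-1" 1] by (simp add: linepath_def add.commute)
  qed
  then have "((\<lambda>t. f (linepath b a t)) has_integral i) {0..1} \<longleftrightarrow>
    ((\<lambda>t. f (linepath a b t)) has_integral i) {0..1}" for i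
    by blast
  then show ?thesis unfolding segment_mean_def integral_def integrable_on_def by simp
qed

text \<open>The direction \<open>b - a\<close> is the first coordinate direction of the unit triangle, so that the integral
  over \<open>t\<close> in \<open>integral_unit_triangle_partial\<close> runs along the two other sides. The
  derivative is passed as \<open>f'\<close> so that the chain rule applies without computing it.\<close>

lemma integral_triangle_along_side:
  fixes f :: "real^2 \<Rightarrow> real"
  assumes d: "\<And>x. (f has_derivative f' x) (at x)" and c: "\<And>d. continuous_on UNIV (\<lambda>x. f' x d)"
  shows "integral (convex hull {a,b,c}) (\<lambda>x. f' x (b - a)) =
    \<bar>cross2 (b-a) (c-a)\<bar> * (segment_mean b c f - segment_mean a c f)"
proof -
  let ?\<phi> = "\<lambda>x::real^2. a + (x$1 *\<^sub>R (b-a) + x$2 *\<^sub>R (c-a))"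
  have cf: "continuous_on UNIV f"
    using d by (meson continuous_at_imp_continuous_on has_derivative_continuous)
  have c\<phi>: "continuous_on UNIV ?\<phi>"
    by (intro continuous_intros)
  have "integral unit_triangle (\<lambda>x. f' (?\<phi> x) (b-a)) =
    integral {0..1} (\<lambda>t. f (?\<phi> (vector [1-t,t])) - f (?\<phi> (vector [0,t])))"
  proof (rule integral_unit_triangle_partial)
    fix s t :: real
    have "((\<lambda>s. ?\<phi> (vector [s,t])) has_derivative (\<lambda>h. h *\<^sub>R (b-a))) (at s)"
      by (auto intro!: derivative_eq_intros)
    from has_derivative_compose[OF this d]
    have "((\<lambda>s. f (?\<phi> (vector [s,t]))) has_derivative (\<lambda>h. f' (?\<phi> (vector [s,t])) (h *\<^sub>R (b-a))))
        (at s)" .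
    moreover have "f' x (h *\<^sub>R y) = f' x y * h" for x h y
      using linear_cmul[OF has_derivative_linear[OF d]] by simp
    ultimately show "((\<lambda>s. f (?\<phi> (vector [s,t]))) has_real_derivative f' (?\<phi> (vector [s,t])) (b-a))
        (at s)"
      by (simp add: has_field_derivative_def)
  next
    show "continuous_on UNIV (\<lambda>x. f' (?\<phi> x) (b-a))"
      by (rule continuous_on_compose2[OF c c\<phi>]) auto
    show "continuous_on UNIV (\<lambda>x. f (?\<phi> x))"
      by (rule continuous_on_compose2[OF cf c\<phi>]) auto
  qed
  also have "\<dots> = integral {0..1} (\<lambda>t. f (linepath b c t) - f (linepath a c t))"
    by (rule Henstock_Kurzweil_Integration.integral_cong) (simp add: linepath_def algebra_simps)
  also have "\<dots> = segment_mean b c f - segment_mean a c f"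
    unfolding segment_mean_def
    by (intro Henstock_Kurzweil_Integration.integral_diff integrable_continuous_interval
        continuous_on_linepath_compose cf)
  finally show ?thesis
    using integral_triangle_unit_triangle[OF c] by (simp add: cross2_def)
qed

text \<open>The two sides \<open>b - a\<close> and \<open>c - a\<close> span the plane and both sides of the equation are linear in
  the direction \<open>v\<close>, so that the preceding lemma, used for each of the two sides,
  suffices. The coefficient \<open>cross2 v (b - a)\<close> is the inner product of \<open>v\<close> with the outward
  normal, times the length of the edge.\<close>

lemma integral_triangle_derivative:
  fixes f :: "real^2 \<Rightarrow> real"
  assumes d: "\<And>x. (f has_derivative f' x) (at x)" and c: "\<And>d. continuous_on UNIV (\<lambda>x. f' x d)"
    and pos: "cross2 (b-a) (c-a) > 0"
  shows "integral (convex hull {a,b,c}) (\<lambda>x. f' x v) =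
    cross2 v (b-a) * segment_mean a b f + cross2 v (c-b) * segment_mean b c f
      + cross2 v (a-c) * segment_mean c a f"
proof -
  let ?K = "convex hull {a,b,c}"
  let ?D = "cross2 (b-a) (c-a)"
  \<comment> \<open>Cramer's rule for the coordinates of \<open>v\<close> with respect to the two sides.\<close>
  define \<alpha> \<beta> where "\<alpha> = cross2 v (c-a) / ?D" and "\<beta> = cross2 (b-a) v / ?D"
  have D\<alpha>: "\<alpha> * ?D = cross2 v (c-a)" "\<beta> * ?D = cross2 (b-a) v"
    using pos by (simp_all add: \<alpha>_def \<beta>_def)
  have "?D *\<^sub>R v = cross2 v (c-a) *\<^sub>R (b-a) + cross2 (b-a) v *\<^sub>R (c-a)"
    by (simp add: vec_eq_iff forall_2 cross2_def algebra_simps)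
  also have "\<dots> = ?D *\<^sub>R (\<alpha> *\<^sub>R (b-a) + \<beta> *\<^sub>R (c-a))"
    by (simp add: scaleR_add_right D\<alpha>[symmetric] mult.commute)
  finally have v: "v = \<alpha> *\<^sub>R (b-a) + \<beta> *\<^sub>R (c-a)"
    using pos by (subst (asm) scaleR_cancel_left) auto
  \<comment> \<open>Directional derivatives are linear in the direction, which is the reduction to the sides.\<close>
  have lin: "f' x v = \<alpha> * f' x (b-a) + \<beta> * f' x (c-a)" for x
    using has_derivative_linear[OF d[of x]] unfolding v by (simp add: linear_add linear_cmul)
  have K: "compact ?K" by (intro finite_imp_compact_convex_hull) simp
  have int: "(\<lambda>x. f' x u) integrable_on ?K" for u
    using compact_absolutely_integrable[OF K continuous_on_subset[OF c]]
        set_lebesgue_integral_eq_integral(1) by blast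
  have 1: "integral ?K (\<lambda>x. f' x (b-a)) = ?D * (segment_mean b c f - segment_mean c a f)"
    using integral_triangle_along_side[OF d c, of a b c] pos by (simp add: segment_mean_commute[of a c])
  have K': "?K = convex hull {a,c,b}" by (simp add: insert_commute)
  have neg: "cross2 (c-a) (b-a) = - ?D" by (simp add: cross2_def)
  have 2: "integral ?K (\<lambda>x. f' x (c-a)) = ?D * (segment_mean b c f - segment_mean a b f)"
    using integral_triangle_along_side[OF d c, of a c b] pos unfolding K' neg
    by (simp add: segment_mean_commute[of b c])
  have "integral ?K (\<lambda>x. f' x v) = \<alpha> * integral ?K (\<lambda>x. f' x (b-a)) + \<beta> * integral ?K (\<lambda>x. f' x (c-a))"
    unfolding lin using int
    by (subst Henstock_Kurzweil_Integration.integral_add) (auto intro!: integrable_on_mult_right)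
  also have "\<dots> = cross2 v (c-a) * (segment_mean b c f - segment_mean c a f)
     + cross2 (b-a) v * (segment_mean b c f - segment_mean a b f)"
    unfolding 1 2 D\<alpha>[symmetric] by (simp add: algebra_simps)
  also have "\<dots> = cross2 v (b-a) * segment_mean a b f + cross2 v (c-b) * segment_mean b c f
      + cross2 v (a-c) * segment_mean c a f"
    by (simp add: cross2_def algebra_simps)
  finally show ?thesis .
qed

section \<open>Arc length and outward normals on the edges of a triangle\<close>

text \<open>Arc length on a segment with a chosen order of the end points, before completion. By
  \<open>edge_measure_closed_segment\<close> the measure of an edge is one of the two candidates.\<close>

definition segment_measure :: "real^2 \<Rightarrow> real^2 \<Rightarrow> (real^2) measure" where
  "segment_measure a b = scale_measure (ennreal (dist a b))
     (distr (lebesgue_on {0..1}) borel (linepath a b))"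

lemma linepath_measurable [measurable]: "linepath a b \<in> lebesgue_on {0..1} \<rightarrow>\<^sub>M borel"
    for a b :: "real^2"
  by (rule continuous_imp_measurable_on_sets_lebesgue) auto

lemma segment_measure_density:
  "segment_measure a b = density (distr (lebesgue_on {0..1}) borel (linepath a b)) (\<lambda>x. ennreal
      (dist a b))"
  unfolding segment_measure_def
  by (rule measure_eqI) (auto simp: emeasure_density_const)

lemma
  fixes f :: "real^2 \<Rightarrow> real"
  assumes f: "continuous_on UNIV f"
  shows integrable_segment_measure: "integrable (completion (segment_measure a b)) f"
    and integral_segment_measure: "(LINT x|completion (segment_measure a b). f x)
        = dist a b * segment_mean a b f"
proof -
  have [measurable]: "f \<in> borel_measurable borel"
    using f by (simp add: borel_measurable_continuous_onI)
  have fM: "f \<in> borel_measurable (segment_measure a b)"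
    by (simp add: segment_measure_density)
  have int: "integrable (lebesgue_on {0..1}) (\<lambda>t. f (linepath a b t))"
    by (intro continuous_imp_integrable_real continuous_on_linepath_compose f)
  show "integrable (completion (segment_measure a b)) f"
    unfolding integrable_completion[OF fM] unfolding segment_measure_density
    by (subst integrable_density) (auto simp: integrable_distr_eq intro: int)
  have "(LINT x|completion (segment_measure a b). f x) = (LINT t|lebesgue_on {0..1}. dist a b * f
      (linepath a b t))"
    unfolding integral_completion[OF fM] unfolding segment_measure_density
    by (subst integral_density) (auto simp: integral_distr)
  also have "\<dots> = dist a b * segment_mean a b f"
    unfolding segment_mean_def using lebesgue_integral_eq_integral[OF int] by simp
  finally show "(LINT x|completion (segment_measure a b). f x) = dist a b * segment_mean a b f" .
qed

lemma AE_segment_measure: "AE x in completion (segment_measure a b). x \<in> closed_segment a b"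
proof (rule AE_completion)
  have "AE x in distr (lebesgue_on {0..1}) borel (linepath a b). x \<in> closed_segment a b"
    by (subst AE_distr_iff) (auto simp: linepath_in_path borel_closed intro!: AE_I2)
  then show "AE x in segment_measure a b. x \<in> closed_segment a b"
    unfolding segment_measure_density by (subst AE_density) auto
qed

lemma edge_measure_closed_segment:
  "edge_measure (closed_segment a b) = completion (segment_measure a b) \<or>
   edge_measure (closed_segment a b) = completion (segment_measure b a)"
proof -
  obtain a' b' where ab: "(SOME (p, q). closed_segment a b = closed_segment p q) = (a', b')"
    by (meson surj_pair)
  have "closed_segment a b = closed_segment a' b'"
    using someI[of "\<lambda>(p, q). closed_segment a b = closed_segment p q" "(a,b)"] unfolding ab by auto
  then have "{a, b} = {a', b'}" by simp
  moreover have "edge_measure (closed_segment a b) = completion (segment_measure a' b')"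
    unfolding edge_measure_def segment_measure_def ab by simp
  ultimately show ?thesis by (auto simp: doubleton_eq_iff)
qed

lemma
  fixes f :: "real^2 \<Rightarrow> real"
  assumes f: "continuous_on UNIV f"
  shows integrable_edge_measure: "integrable (edge_measure (closed_segment a b)) f"
    and integral_edge_measure: "(LINT x|edge_measure (closed_segment a b). f x)
        = dist a b * segment_mean a b f"
  using edge_measure_closed_segment[of a b] integrable_segment_measure[OF f]
      integral_segment_measure[OF f]
  by (auto simp: segment_mean_commute[of b a] dist_commute)

lemma AE_edge_measure: "AE x in edge_measure (closed_segment a b). x \<in> closed_segment a b"
  using edge_measure_closed_segment[of a b]
proof
  assume e: "edge_measure (closed_segment a b) = completion (segment_measure a b)"
  show ?thesis unfolding e by (rule AE_segment_measure)
next
  assume e: "edge_measure (closed_segment a b) = completion (segment_measure b a)"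
  show ?thesis unfolding e by (subst closed_segment_commute) (rule AE_segment_measure)
qed

text \<open>Turning the sides of a counterclockwise triangle clockwise by a right angle makes them
  point outward.\<close>

definition rotate_clockwise :: "real^2 \<Rightarrow> real^2" where
  "rotate_clockwise v = vector [v$2, - v$1]"

text \<open>A vector \<open>\<nu>\<close> admitted by the definition satisfies \<open>\<nu> \<bullet> (b - a) = 0\<close>, as both end points lie in the
  edge and in the triangle. Hence it is a multiple of the rotated side; its length fixes the modulus
  of the factor and the third vertex fixes the sign.\<close>

lemma outward_normal_triangle:
  assumes pos: "cross2 (b-a) (c-a) > 0"
  shows "outward_normal (convex hull {a,b,c}) (closed_segment a b)
      = rotate_clockwise (b-a) /\<^sub>R dist a b"
proof -
  let ?r = "rotate_clockwise (b-a)"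
  have ip: "?r \<bullet> v = - cross2 (b-a) v" for v
    by (simp add: rotate_clockwise_def inner_vec_def sum_2 cross2_def algebra_simps)
  have nr: "norm ?r = dist a b"
    by (simp add: rotate_clockwise_def norm_vec_def L2_set_def sum_2 dist_norm norm_minus_commute[of
        a] add.commute)
      (simp add: power2_commute)
  have ab: "a \<noteq> b" using pos by (auto simp: cross2_def)
  \<comment> \<open>Uniqueness, by expanding \<open>\<nu>\<close> in the orthogonal basis of the side and the rotated side.\<close>
  have un: "\<nu> = ?r /\<^sub>R dist a b" if n: "norm \<nu> = 1" and le: "\<forall>x\<in>closed_segment a b. \<forall>y\<in>convex hull
      {a,b,c}. \<nu> \<bullet> (y - x) \<le> 0" for \<nu>
  proof -
    have H: "{a,b,c} \<subseteq> convex hull {a,b,c}" by (rule hull_subset)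
    have "\<nu> \<bullet> (b - a) \<le> 0" "\<nu> \<bullet> (a - b) \<le> 0" and nc: "\<nu> \<bullet> (c - a) \<le> 0"
      using le H by auto
    then have z: "\<nu> \<bullet> (b - a) = 0" by (simp add: inner_diff_right)
    define l where "l = (\<nu> \<bullet> ?r) / (dist a b)\<^sup>2"
    have dd: "(dist a b)\<^sup>2 = ((b-a)$1)\<^sup>2 + ((b-a)$2)\<^sup>2"
      using nr by (simp add: dist_norm norm_vec_def L2_set_def sum_2 power2_commute)
    have "(dist a b)\<^sup>2 *\<^sub>R \<nu> = (\<nu> \<bullet> ?r) *\<^sub>R ?r + (\<nu> \<bullet> (b-a)) *\<^sub>R (b-a)"
      unfolding dd by (simp add: vec_eq_iff forall_2 rotate_clockwise_def inner_vec_def sum_2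
          power2_eq_square algebra_simps)
    then have "(dist a b)\<^sup>2 *\<^sub>R \<nu> = (dist a b)\<^sup>2 *\<^sub>R (l *\<^sub>R ?r)"
      using z ab by (simp add: l_def)
    then have \<nu>: "\<nu> = l *\<^sub>R ?r" using ab by (subst (asm) scaleR_cancel_left) auto
    then have "l * cross2 (b-a) (c-a) \<ge> 0" using nc ip by simp
    then have "l \<ge> 0" using pos by (simp add: zero_le_mult_iff)
    moreover have "\<bar>l\<bar> * dist a b = 1" using n \<nu> nr by simp
    ultimately have "l = inverse (dist a b)" using ab by (simp add: field_simps)
    then show ?thesis using \<nu> by simp
  qed
  have ok: "\<forall>x\<in>closed_segment a b. \<forall>y\<in>convex hull {a,b,c}. (?r /\<^sub>R dist a b) \<bullet> (y - x) \<le> 0"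
  proof (intro ballI)
    fix x y assume "x \<in> closed_segment a b" "y \<in> convex hull {a,b,c}"
    then obtain t u v w where x: "x = (1-t) *\<^sub>R a + t *\<^sub>R b" and
      y: "0 \<le> u" "0 \<le> v" "0 \<le> w" "u + v + w = 1" "y = u *\<^sub>R a + v *\<^sub>R b + w *\<^sub>R c"
      unfolding convex_hull_3 closed_segment_def by auto
    have u: "u = 1 - v - w" using y by simp
    have yx: "y - x = (v - t) *\<^sub>R (b-a) + w *\<^sub>R (c-a)"
      unfolding x y u by (simp add: algebra_simps)
    have "?r \<bullet> (y - x) = - w * cross2 (b-a) (c-a)"
      unfolding ip yx by (simp add: cross2_def algebra_simps)
    then have "?r \<bullet> (y - x) \<le> 0" using y pos by simp
    then show "(?r /\<^sub>R dist a b) \<bullet> (y - x) \<le> 0"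
      by (simp add: mult_nonneg_nonpos)
  qed
  show ?thesis unfolding outward_normal_def
    by (rule the_equality) (use ok un nr ab in auto)
qed

text \<open>The length of the edge, which normalizes the outward normal, is also the density of arc length
  with respect to the parameter of the segment. The two cancel.\<close>

lemma integral_edge_normal:
  fixes f :: "real^2 \<Rightarrow> real"
  assumes "cross2 (b-a) (c-a) > 0" and "continuous_on UNIV f"
  shows "(v \<bullet> outward_normal (convex hull {a,b,c}) (closed_segment a b)) * (LINT x|edge_measure
      (closed_segment a b). f x)
     = cross2 v (b-a) * segment_mean a b f"
proof -
  have "a \<noteq> b" using assms(1) by (auto simp: cross2_def)
  then show ?thesis
    unfolding outward_normal_triangle[OF assms(1)] integral_edge_measure[OF assms(2)]
    by (simp add: rotate_clockwise_def cross2_def inner_vec_def sum_2 field_simps)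
qed

section \<open>Green's formula on a triangle\<close>

lemma has_derivative_frechet_polynomial:
  fixes f :: "'a::euclidean_space \<Rightarrow> 'b::euclidean_space"
  assumes "polynomial_function f"
  shows "(f has_derivative frechet_derivative f (at x)) (at x)"
  using differentiable_at_polynomial_function[OF assms] frechet_derivative_works by blast

text \<open>By induction on the construction of polynomials: the derivatives of sums and products are
  built from continuous functions.\<close>

lemma continuous_frechet_real_polynomial:
  fixes f :: "'a::euclidean_space \<Rightarrow> real"
  assumes "real_polynomial_function f"
  shows "continuous_on UNIV (\<lambda>x. frechet_derivative f (at x) d)"
  using assms
proof (induction f)
  case (linear f)
  then have "frechet_derivative f (at x) = f" for x
    by (metis bounded_linear_imp_has_derivative frechet_derivative_at)
  then show ?case by simp
next
  case (const c)
  have "frechet_derivative (\<lambda>x::'a. c) (at x) = (\<lambda>_. 0)" for x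
    by (metis has_derivative_const frechet_derivative_at)
  then show ?case by simp
next
  case (add f g)
  have "frechet_derivative (\<lambda>x. f x + g x) (at x) =
      (\<lambda>h. frechet_derivative f (at x) h + frechet_derivative g (at x) h)" for x
    using add.hyps by (intro frechet_derivative_at[symmetric] has_derivative_add
        has_derivative_frechet_polynomial)
      (simp_all add: real_polynomial_function_eq)
  then show ?case using add.IH by (simp add: continuous_on_add)
next
  case (mult f g)
  have "frechet_derivative (\<lambda>x. f x * g x) (at x) =
      (\<lambda>h. f x * frechet_derivative g (at x) h + frechet_derivative f (at x) h * g x)" for x
    using mult.hyps by (intro frechet_derivative_at[symmetric] has_derivative_mult
        has_derivative_frechet_polynomial)
      (simp_all add: real_polynomial_function_eq)
  moreover have "continuous_on UNIV f" "continuous_on UNIV g"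
    using mult.hyps by (simp_all add: continuous_on_polymonial_function real_polynomial_function_eq)
  ultimately show ?case using mult.IH by (simp add: continuous_intros)
qed

lemma polynomial_function_component:
  fixes v :: "real^2 \<Rightarrow> real^2"
  assumes "polynomial_function v"
  shows "real_polynomial_function (\<lambda>x. v x $ i)"
  using assms[unfolded polynomial_function_def, rule_format, OF bounded_linear_vec_nth[of i]]
  by (simp add: o_def)

lemma frechet_derivative_component:
  fixes v :: "real^2 \<Rightarrow> real^2"
  assumes "polynomial_function v"
  shows "frechet_derivative v (at x) h $ i = frechet_derivative (\<lambda>x. v x $ i) (at x) h"
proof -
  have "((\<lambda>x. v x $ i) has_derivative (\<lambda>h. frechet_derivative v (at x) h $ i)) (at x)"
    by (rule bounded_linear.has_derivative[OF bounded_linear_vec_nth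
        has_derivative_frechet_polynomial[OF assms]])
  from frechet_derivative_at[OF this] show ?thesis by metis
qed

lemma continuous_grad:
  assumes "polynomial_function w"
  shows "continuous_on UNIV (grad w)"
  unfolding grad_def using assms
  by (intro continuous_on_vec_lambda continuous_frechet_real_polynomial)
      (simp add: real_polynomial_function_eq)

lemma continuous_divergence:
  assumes "polynomial_function v"
  shows "continuous_on UNIV (divergence v)"
  unfolding divergence_def frechet_derivative_component[OF assms]
  by (intro continuous_on_sum continuous_frechet_real_polynomial polynomial_function_component assms)

lemma divergence_mult:
  assumes w: "polynomial_function w" and v: "polynomial_function v"
  shows "(\<Sum>i\<in>UNIV. frechet_derivative (\<lambda>x. w x * v x $ i) (at x) (axis i 1)) =
    w x * divergence v x + v x \<bullet> grad w x"
proof -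
  have "frechet_derivative (\<lambda>x. w x * v x $ i) (at x) =
      (\<lambda>h. w x * frechet_derivative (\<lambda>x. v x $ i) (at x) h + frechet_derivative w (at x) h * v x $
          i)" for i
    using polynomial_function_component[OF v]
    by (intro frechet_derivative_at[symmetric] has_derivative_mult has_derivative_frechet_polynomial w)
      (simp add: real_polynomial_function_eq)
  then show ?thesis
    by (simp add: divergence_def frechet_derivative_component[OF v] grad_def inner_vec_def
        sum_distrib_left
        sum.distrib mult.commute)
qed

text \<open>Vertices with vanishing determinant would lie on a line, whose dimension is too small for three
  affinely independent points. Exchanging two vertices changes the sign of the
  determinant.\<close>

lemma two_simplex_vertices:
  assumes "2 simplex K"
  obtains a b c where "K = convex hull {a,b,c}" "cross2 (b-a) (c-a) > 0" "\<not> affine_dependent {a,b,c}"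
proof -
  obtain C where C: "\<not> affine_dependent C" "card C = 3" "K = convex hull C"
    using assms unfolding simplex_def by auto
  then obtain a b c where abc: "C = {a,b,c}" "a \<noteq> b" "b \<noteq> c" "a \<noteq> c"
    by (auto simp: card_3_iff)
  have nz: "cross2 (b-a) (c-a) \<noteq> 0"
  proof
    assume z: "cross2 (b-a) (c-a) = 0"
    let ?r = "rotate_clockwise (b-a)"
    have "?r \<noteq> 0" using abc by (auto simp: rotate_clockwise_def vec_eq_iff forall_2)
    \<comment> \<open>The rotated side is normal to the line through the three points.\<close>
    have "C \<subseteq> {x. ?r \<bullet> x = ?r \<bullet> a}"
      using z by (auto simp: abc rotate_clockwise_def cross2_def inner_vec_def sum_2 algebra_simps)
    then have "aff_dim C \<le> aff_dim {x. ?r \<bullet> x = ?r \<bullet> a}" by (rule aff_dim_subset)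
    also have "\<dots> = 1" using \<open>?r \<noteq> 0\<close> by (subst aff_dim_hyperplane) auto
    finally show False
      using aff_dim_affine_independent[OF C(1)] C(2) by simp
  qed
  show thesis
  proof (cases "cross2 (b-a) (c-a) > 0")
    case True
    then show ?thesis using that C abc by blast
  next
    case False
    moreover have "cross2 (c-a) (b-a) = - cross2 (b-a) (c-a)" by (simp add: cross2_def)
    ultimately have "cross2 (c-a) (b-a) > 0" using nz by simp
    moreover have "C = {a,c,b}" using abc by auto
    ultimately show ?thesis using that C by blast
  qed
qed

lemma facets_triangle:
  assumes "\<not> affine_dependent {a,b,c}" and "a \<noteq> b" "b \<noteq> c" "a \<noteq> c"
  shows "{E. E facet_of (convex hull {a,b,c})} = {closed_segment a b, closed_segment b c,
      closed_segment c a}"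
proof -
  have del: "{a,b,c} - {a} = {b,c}" "{a,b,c} - {b} = {c,a}" "{a,b,c} - {c} = {a,b}"
    using assms(2-4) by auto
  have "E facet_of (convex hull {a,b,c}) \<longleftrightarrow>
     E \<noteq> {} \<and> (E = closed_segment b c \<or> E = closed_segment c a \<or> E = closed_segment a b)" for E
    unfolding facet_of_convex_hull_affine_independent[OF assms(1)] segment_convex_hull
    using del by (metis insertI1 insertI2 insertE singletonD)
  then show ?thesis by auto
qed

lemma lebesgue_integral_compact:
  fixes f :: "real^2 \<Rightarrow> real"
  assumes "compact K" "continuous_on UNIV f"
  shows "integrable (lebesgue_on K) f" "(LINT x|lebesgue_on K. f x) = integral K f"
proof -
  have K: "K \<in> sets lebesgue" using assms(1) by (simp add: borel_compact sets_completionI_sets)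
  show *: "integrable (lebesgue_on K) f"
    by (intro absolutely_integrable_imp_integrable compact_absolutely_integrable K assms
        continuous_on_subset[OF assms(2)]) auto
  show "(LINT x|lebesgue_on K. f x) = integral K f"
    by (rule lebesgue_integral_eq_integral[OF * K])
qed

lemma two_simplex_compact: "2 simplex K \<Longrightarrow> compact K"
  by (auto simp: simplex intro: finite_imp_compact_convex_hull)

text \<open>The divergence of \<open>w v\<close> is \<open>w\<close> times the divergence of \<open>v\<close> plus \<open>v \<bullet> \<nabla>w\<close>. The formula is
  the sum over \<open>i\<close> of \<open>integral_triangle_derivative\<close> for \<open>w v\<^sub>i\<close> in the direction of the
  \<open>i\<close>-th unit vector, where the three edges are obtained from one another by cyclic permutation
  of the vertices.\<close>

lemma green_triangle:
  assumes K: "2 simplex K" and w: "polynomial_function w" and v: "polynomial_function v"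
  shows "(LINT x|lebesgue_on K. w x * divergence v x) + (LINT x|lebesgue_on K. v x \<bullet> grad w x) =
    (\<Sum>E | E facet_of K. LINT x|edge_measure E. w x * (v x \<bullet> outward_normal K E))"
proof -
  from two_simplex_vertices[OF K] obtain a b c where Kabc: "K = convex hull {a,b,c}" and
    pos: "cross2 (b-a) (c-a) > 0" and ind: "\<not> affine_dependent {a,b,c}" .
  have dist: "a \<noteq> b" "b \<noteq> c" "a \<noteq> c" using pos by (auto simp: cross2_def)
  have Kc: "compact K" using K by (rule two_simplex_compact)
  let ?f = "\<lambda>i x. w x * v x $ i"
  have pf: "real_polynomial_function (?f i)" for i
    using real_polynomial_function.intros(4)[OF _ polynomial_function_component[OF v], of w] w
    by (simp add: real_polynomial_function_eq)
  have cf: "continuous_on UNIV (?f i)" for i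
    using pf by (simp add: continuous_on_polymonial_function real_polynomial_function_eq)
  have cw: "continuous_on UNIV w" and cv: "continuous_on UNIV v"
    using w v by (simp_all add: continuous_on_polymonial_function)
  have cyc': "cross2 (c-b) (a-b) = cross2 (b-a) (c-a)" "cross2 (a-c) (b-c) = cross2 (b-a) (c-a)"
    by (simp_all add: cross2_def algebra_simps)
  then have cyc: "cross2 (c-b) (a-b) > 0" "cross2 (a-c) (b-c) > 0"
    using pos by simp_all
  have hull: "K = convex hull {b,c,a}" "K = convex hull {c,a,b}"
    unfolding Kabc by (simp_all add: insert_commute)
  have gauss: "integral K (\<lambda>x. frechet_derivative (?f i) (at x) d) =
    (\<Sum>E | E facet_of K. (d \<bullet> outward_normal K E) * (LINT x|edge_measure E. ?f i x))" for i d
  proof -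
    have "integral K (\<lambda>x. frechet_derivative (?f i) (at x) d) =
      cross2 d (b-a) * segment_mean a b (?f i) + cross2 d (c-b) * segment_mean b c (?f i)
      + cross2 d (a-c) * segment_mean c a (?f i)"
      unfolding Kabc
    proof (rule integral_triangle_derivative[OF _ _ pos])
      show "(?f i has_derivative frechet_derivative (?f i) (at x)) (at x)" for x
        using pf[of i] by (intro has_derivative_frechet_polynomial)
            (simp add: real_polynomial_function_eq)
      show "continuous_on UNIV (\<lambda>x. frechet_derivative (?f i) (at x) d)" for d
        by (rule continuous_frechet_real_polynomial[OF pf])
    qed
    also have "cross2 d (b-a) * segment_mean a b (?f i) =
        (d \<bullet> outward_normal K (closed_segment a b)) * (LINT x|edge_measure (closed_segment a b). ?f
            i x)"
      unfolding Kabc by (rule integral_edge_normal[OF pos cf, symmetric])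
    also have "cross2 d (c-b) * segment_mean b c (?f i) =
        (d \<bullet> outward_normal K (closed_segment b c)) * (LINT x|edge_measure (closed_segment b c). ?f
            i x)"
      unfolding hull(1) by (rule integral_edge_normal[OF cyc(1) cf, symmetric])
    also have "cross2 d (a-c) * segment_mean c a (?f i) =
        (d \<bullet> outward_normal K (closed_segment c a)) * (LINT x|edge_measure (closed_segment c a). ?f
            i x)"
      unfolding hull(2) by (rule integral_edge_normal[OF cyc(2) cf, symmetric])
    finally show ?thesis
      unfolding Kabc facets_triangle[OF ind dist] using dist
      by (simp add: doubleton_eq_iff)
  qed
  have "(LINT x|lebesgue_on K. w x * divergence v x) + (LINT x|lebesgue_on K. v x \<bullet> grad w x) =
     (LINT x|lebesgue_on K. w x * divergence v x + v x \<bullet> grad w x)"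
    by (intro Bochner_Integration.integral_add[symmetric] lebesgue_integral_compact(1)[OF Kc]
        continuous_intros
        cw cv continuous_grad[OF w] continuous_divergence[OF v])
  also have "\<dots> = integral K (\<lambda>x. \<Sum>i\<in>UNIV. frechet_derivative (?f i) (at x) (axis i 1))"
    unfolding divergence_mult[OF w v]
    by (intro lebesgue_integral_compact(2)[OF Kc] continuous_intros cw cv continuous_grad[OF w]
        continuous_divergence[OF v])
  also have "\<dots> = (\<Sum>i\<in>UNIV. integral K (\<lambda>x. frechet_derivative (?f i) (at x) (axis i 1)))"
  proof (rule Henstock_Kurzweil_Integration.integral_sum)
    fix i :: 2
    have "continuous_on K (\<lambda>x. frechet_derivative (?f i) (at x) (axis i 1))"
      using continuous_frechet_real_polynomial[OF pf] continuous_on_subset by blast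
    from compact_absolutely_integrable[OF Kc this]
    show "(\<lambda>x. frechet_derivative (?f i) (at x) (axis i 1)) integrable_on K"
      using set_lebesgue_integral_eq_integral(1) by blast
  qed simp
  also have "\<dots> = (\<Sum>E | E facet_of K. \<Sum>i\<in>UNIV. (axis i 1 \<bullet> outward_normal K E) * (LINT x|edge_measure
      E. ?f i x))"
    unfolding gauss by (rule sum.swap)
  also have "\<dots> = (\<Sum>E | E facet_of K. LINT x|edge_measure E. w x * (v x \<bullet> outward_normal K E))"
  proof (rule sum.cong[OF refl])
    fix E assume "E \<in> {E. E facet_of K}"
    then have "\<exists>p q. E = closed_segment p q" unfolding Kabc facets_triangle[OF ind dist] by blast
    then have int: "integrable (edge_measure E) (?f i)" for i
      using integrable_edge_measure[OF cf] by blast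
    let ?n = "outward_normal K E"
    have "(LINT x|edge_measure E. w x * (v x \<bullet> ?n)) = (LINT x|edge_measure E. (\<Sum>i\<in>UNIV. ?n $ i * ?f
        i x))"
      by (intro Bochner_Integration.integral_cong refl)
          (simp add: inner_vec_def sum_distrib_left algebra_simps)
    also have "\<dots> = (\<Sum>i\<in>UNIV. ?n $ i * (LINT x|edge_measure E. ?f i x))"
      using int by (subst Bochner_Integration.integral_sum) auto
    finally show "(\<Sum>i\<in>UNIV. (axis i 1 \<bullet> ?n) * (LINT x|edge_measure E. ?f i x))
        = (LINT x|edge_measure E. w x * (v x \<bullet> ?n))"
      by (simp add: inner_axis')
  qed
  finally show ?thesis .
qed

section \<open>Functions that are continuous up to null sets\<close>

text \<open>Needed since members of the discrete spaces are polynomial only up to null sets, so their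
  measurability on a cell or an edge has to be inherited from the polynomial.\<close>

lemma (in complete_measure) borel_measurable_AE_eq:
  fixes f g :: "'a \<Rightarrow> 'b::topological_space"
  assumes f: "f \<in> borel_measurable M" and ae: "AE x in M. g x = f x"
  shows "g \<in> borel_measurable M"
proof (rule measurableI)
  fix A :: "'b set" assume A: "A \<in> sets borel"
  show "g -` A \<inter> space M \<in> sets M"
  proof (rule in_sets_AE)
    show "AE x in M. x \<in> f -` A \<inter> space M \<longleftrightarrow> x \<in> g -` A \<inter> space M"
      using ae by eventually_elim auto
    show "f -` A \<inter> space M \<in> sets M" using f A by (rule measurable_sets)
  qed auto
qed simp

text \<open>The common property of Lebesgue measure on a cell and of arc length on an edge that makes
  all integrals of the scheme well defined. Completeness lets integrands be changed on null sets.\<close>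

definition integrates_continuous :: "(real^2) measure \<Rightarrow> bool" where
  "integrates_continuous M \<longleftrightarrow> complete_measure M \<and>
     (\<forall>f :: real^2 \<Rightarrow> real. continuous_on UNIV f \<longrightarrow> integrable M f)"

text \<open>Continuity of the representative on the whole plane, not only on a cell, lets one notion
  serve cells and edges alike; polynomials satisfy it.\<close>

definition essentially_continuous :: "(real^2) measure \<Rightarrow> (real^2 \<Rightarrow> 'b::topological_space) \<Rightarrow> bool" where
  "essentially_continuous M f \<longleftrightarrow> (\<exists>p. continuous_on UNIV p \<and> (AE x in M. f x = p x))"

lemma essentially_continuous_continuous: "continuous_on UNIV f \<Longrightarrow> essentially_continuous M f"
  unfolding essentially_continuous_def by auto

lemma essentially_continuous_AE: "continuous_on UNIV p \<Longrightarrow> AE x in M. f x = p x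
    \<Longrightarrow> essentially_continuous M f"
  unfolding essentially_continuous_def by auto

lemma essentially_continuous_compose:
  assumes "essentially_continuous M f" and h: "continuous_on UNIV h"
  shows "essentially_continuous M (\<lambda>x. h (f x))"
proof -
  obtain p where p: "continuous_on UNIV p" "AE x in M. f x = p x"
    using assms(1) unfolding essentially_continuous_def by auto
  have "continuous_on UNIV (\<lambda>x. h (p x))"
    by (rule continuous_on_compose2[OF h p(1)]) auto
  moreover have "AE x in M. h (f x) = h (p x)" using p(2) by eventually_elim simp
  ultimately show ?thesis by (rule essentially_continuous_AE)
qed

lemma essentially_continuous_Pair:
  assumes "essentially_continuous M f" "essentially_continuous M g"
  shows "essentially_continuous M (\<lambda>x. (f x, g x))"
proof -
  obtain p q where p: "continuous_on UNIV p" "AE x in M. f x = p x"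
    and q: "continuous_on UNIV q" "AE x in M. g x = q x"
    using assms unfolding essentially_continuous_def by auto
  have "AE x in M. (f x, g x) = (p x, q x)" using p(2) q(2) by eventually_elim simp
  with continuous_on_Pair[OF p(1) q(1)] show ?thesis by (rule essentially_continuous_AE)
qed

lemma essentially_continuous_compose2:
  assumes "essentially_continuous M f" "essentially_continuous M g" 
    and "continuous_on UNIV (\<lambda>z. h (fst z) (snd z))"
  shows "essentially_continuous M (\<lambda>x. h (f x) (g x))"
  using essentially_continuous_compose[OF essentially_continuous_Pair[OF assms(1,2)] assms(3)] by simp

named_theorems ess_cont

lemma essentially_continuous_const [ess_cont]: "essentially_continuous M (\<lambda>x. c)"
  by (rule essentially_continuous_continuous) simp

lemma essentially_continuous_arith [ess_cont]:
  fixes f g :: "real^2 \<Rightarrow> 'b::real_normed_vector"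
  assumes "essentially_continuous M f" "essentially_continuous M g"
  shows "essentially_continuous M (\<lambda>x. f x + g x)" "essentially_continuous M (\<lambda>x. f x - g x)"
  using essentially_continuous_compose2[OF assms, of "\<lambda>a b. a + b"]
    essentially_continuous_compose2[OF assms, of "\<lambda>a b. a - b"]
  by (simp_all add: continuous_intros)

lemma essentially_continuous_scaleR [ess_cont]:
  fixes f :: "real^2 \<Rightarrow> 'b::real_normed_vector"
  assumes "essentially_continuous M f"
  shows "essentially_continuous M (\<lambda>x. c *\<^sub>R f x)"
  using essentially_continuous_compose[OF assms, of "\<lambda>a. c *\<^sub>R a"] by (simp add: continuous_intros)

lemma essentially_continuous_inner [ess_cont]:
  fixes f g :: "real^2 \<Rightarrow> 'b::real_inner"
  assumes "essentially_continuous M f" "essentially_continuous M g"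
  shows "essentially_continuous M (\<lambda>x. f x \<bullet> g x)"
  using essentially_continuous_compose2[OF assms, of "\<lambda>a b. a \<bullet> b"] by (simp add: continuous_intros)

lemma essentially_continuous_mult [ess_cont]:
  fixes f g :: "real^2 \<Rightarrow> real"
  assumes "essentially_continuous M f" "essentially_continuous M g"
  shows "essentially_continuous M (\<lambda>x. f x * g x)"
  using essentially_continuous_compose2[OF assms, of "\<lambda>a b. a * b"] by (simp add: continuous_intros)

lemma essentially_continuous_power [ess_cont]:
  fixes f :: "real^2 \<Rightarrow> real"
  assumes "essentially_continuous M f"
  shows "essentially_continuous M (\<lambda>x. f x ^ n)"
  using essentially_continuous_compose[OF assms, of "\<lambda>a. a ^ n"] by (simp add: continuous_intros)

lemma essentially_continuous_integrable:
  assumes M: "integrates_continuous M" and f: "essentially_continuous M (f :: real^2 \<Rightarrow> real)"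
  shows "integrable M f"
proof -
  interpret complete_measure M using M unfolding integrates_continuous_def by blast
  obtain p where p: "continuous_on UNIV p" "AE x in M. f x = p x"
    using f unfolding essentially_continuous_def by auto
  have ip: "integrable M p" using M p(1) unfolding integrates_continuous_def by blast
  then have "f \<in> borel_measurable M" using p(2) borel_measurable_AE_eq by blast
  then show ?thesis
    using ip p(2) by (subst integrable_cong_AE[of f M p]) auto
qed

lemma integral_AE_eq:
  fixes f g :: "real^2 \<Rightarrow> real"
  assumes M: "integrates_continuous M" and f: "essentially_continuous M f" and ae: "AE x in M. g x
      = f x"
  shows "(LINT x|M. g x) = (LINT x|M. f x)"
proof -
  interpret complete_measure M using M unfolding integrates_continuous_def by blast
  have "f \<in> borel_measurable M" using essentially_continuous_integrable[OF M f] by auto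
  then show ?thesis using ae borel_measurable_AE_eq by (intro integral_cong_AE) auto
qed

lemma integrates_continuous_edge_measure: "integrates_continuous (edge_measure (closed_segment a b))"
proof -
  have "complete_measure (edge_measure (closed_segment a b))"
    using edge_measure_closed_segment[of a b] completion.complete_measure_axioms by metis
  then show ?thesis
    unfolding integrates_continuous_def using integrable_edge_measure by blast
qed

text \<open>Completeness passes from Lebesgue measure to its restriction to a measurable set.\<close>

lemma integrates_continuous_lebesgue_on:
  assumes "compact K"
  shows "integrates_continuous (lebesgue_on K)"
proof -
  have K: "K \<in> sets lebesgue" using assms by (simp add: borel_compact sets_completionI_sets)
  have "complete_measure (lebesgue_on K)"
  proof
    fix A B assume "B \<subseteq> A" "A \<in> null_sets (lebesgue_on K)"
    then have "B \<subseteq> K" "B \<in> null_sets lebesgue"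
      using null_sets_restrict_space[OF K] completion.complete2 by blast+
    then show "B \<in> sets (lebesgue_on K)"
      using null_sets_restrict_space[OF K] by blast
  qed
  then show ?thesis
    unfolding integrates_continuous_def using lebesgue_integral_compact(1)[OF assms] by blast
qed

section \<open>Piecewise polynomial spaces\<close>

lemma two_simplex_closure_interior:
  assumes "2 simplex (K :: (real^2) set)"
  shows "closure (interior K) = K"
proof -
  have "convex K" "compact K" using assms by (auto simp: simplex convex_convex_hull intro:
      finite_imp_compact_convex_hull)
  moreover have "interior K \<noteq> {}"
  proof -
    have "aff_dim K = DIM(real^2)" using aff_dim_simplex[OF assms] by simp
    then have "rel_interior K = interior K" and "K \<noteq> {}"
      using aff_dim_eq_full[of K] rel_interior_interior[of K] by force+
    then show ?thesis using rel_interior_eq_empty[OF \<open>convex K\<close>] by simp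
  qed
  ultimately show ?thesis
    using convex_closure_interior compact_imp_closed closure_closed by metis
qed

text \<open>The set where two continuous functions differ is open. If it is null in the cell, it misses the
  interior, whose closure is the whole cell. This is what makes the polynomial of a class
  unique on a cell, including its trace on the boundary.\<close>

lemma AE_eq_continuous_on_cell:
  fixes p q :: "real^2 \<Rightarrow> 'b::real_normed_vector"
  assumes K: "2 simplex K" and p: "continuous_on UNIV p" and q: "continuous_on UNIV q"
    and ae: "AE x in lebesgue_on K. p x = q x" and x: "x \<in> K"
  shows "p x = q x"
proof -
  let ?N = "{x. p x \<noteq> q x}"
  have cl: "closed {x. p x = q x}" using p q by (rule closed_Collect_eq)
  have "K \<in> sets lebesgue" using two_simplex_compact[OF K] by
      (simp add: borel_compact sets_completionI_sets)
  then have "AE x in lebesgue. x \<in> K \<longrightarrow> p x = q x" using ae by (simp add: AE_restrict_space_iff)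
  then have "{x. \<not> (x \<in> K \<longrightarrow> p x = q x)} \<in> null_sets lebesgue"
    by (subst (asm) completion.AE_iff_null_sets) simp
  then have "negligible {x. x \<in> K \<and> p x \<noteq> q x}" by (simp add: negligible_iff_null_sets)
  then have "negligible (interior K \<inter> ?N)"
    by (rule negligible_subset) (use interior_subset in auto)
  moreover have "open ?N" using cl by (simp add: closed_def Collect_neg_eq)
  ultimately have "interior K \<inter> ?N = {}"
    using open_not_negligible open_Int open_interior by blast
  then have "interior K \<subseteq> {x. p x = q x}" by auto
  then have "closure (interior K) \<subseteq> {x. p x = q x}" using cl by (rule closure_minimal)
  then show ?thesis using x two_simplex_closure_interior[OF K] by auto
qed

text \<open>Any polynomial that represents the class on the cell shows that the choice in the definition
  of \<open>piece\<close> is made from a nonempty set.\<close>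

lemma piece_works:
  assumes "polynomial_function p" "AE x in lebesgue_on K. f x = p x"
  shows "polynomial_function (piece K f)" "AE x in lebesgue_on K. f x = piece K f x"
  using someI[of "\<lambda>p. polynomial_function p \<and> (AE x in lebesgue_on K. f x = p x)" p] assms
  unfolding piece_def by auto

lemma poly_space_polynomial: "p \<in> poly_space k \<Longrightarrow> real_polynomial_function p"
proof -
  assume "p \<in> poly_space k"
  then obtain c where p: "p = (\<lambda>x. \<Sum>i\<le>k. \<Sum>j\<le>k - i. c i j * (x $ 1) ^ i * (x $ 2) ^ j)"
    unfolding poly_space_def by (auto simp: fun_eq_iff)
  have "real_polynomial_function (\<lambda>x::real^2. x $ i)" for i
    by (rule real_polynomial_function.intros(1)[OF bounded_linear_vec_nth])
  then show ?thesis
    unfolding p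
    by (intro real_polynomial_function_sum real_polynomial_function.intros(4)
      real_polynomial_function.intros(2) real_polynomial_function_power finite_atMost)
qed

lemma poly_space_lincomb:
  assumes "p \<in> poly_space k" "q \<in> poly_space k"
  shows "(\<lambda>x. s * p x + t * q x) \<in> poly_space k"
proof -
  obtain c d where c: "\<And>x. p x = (\<Sum>i\<le>k. \<Sum>j\<le>k - i. c i j * (x $ 1) ^ i * (x $ 2) ^ j)"
    and d: "\<And>x. q x = (\<Sum>i\<le>k. \<Sum>j\<le>k - i. d i j * (x $ 1) ^ i * (x $ 2) ^ j)"
    using assms unfolding poly_space_def by auto
  show ?thesis unfolding poly_space_def mem_Collect_eq
    by (intro exI[of _ "\<lambda>i j. s * c i j + t * d i j"] allI)
      (simp add: c d sum_distrib_left sum.distrib algebra_simps)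
qed

text \<open>By \<open>(a + b)\<^sup>2 \<le> 2 a\<^sup>2 + 2 b\<^sup>2\<close>. The test functions of the energy argument are combinations of
  discrete solutions, and have to be shown to belong to the discrete spaces.\<close>

lemma square_integrable_lincomb:
  fixes f g :: "'a \<Rightarrow> 'b::euclidean_space"
  assumes "square_integrable M f" "square_integrable M g"
  shows "square_integrable M (\<lambda>x. s *\<^sub>R f x + t *\<^sub>R g x)"
proof -
  have [measurable]: "f \<in> borel_measurable M" "g \<in> borel_measurable M"
    and i: "integrable M (\<lambda>x. (norm (f x))\<^sup>2)" "integrable M (\<lambda>x. (norm (g x))\<^sup>2)"
    using assms unfolding square_integrable_def by auto
  have "integrable M (\<lambda>x. (norm (s *\<^sub>R f x + t *\<^sub>R g x))\<^sup>2)"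
  proof (rule Bochner_Integration.integrable_bound)
    show "integrable M (\<lambda>x. 2 * s\<^sup>2 * (norm (f x))\<^sup>2 + 2 * t\<^sup>2 * (norm (g x))\<^sup>2)"
      using i by simp
    have "(norm (s *\<^sub>R f x + t *\<^sub>R g x))\<^sup>2 \<le> 2 * s\<^sup>2 * (norm (f x))\<^sup>2 + 2 * t\<^sup>2 * (norm (g x))\<^sup>2" for x
    proof -
      have "(norm (s *\<^sub>R f x + t *\<^sub>R g x))\<^sup>2 \<le> (norm (s *\<^sub>R f x) + norm (t *\<^sub>R g x))\<^sup>2"
        by (intro power_mono norm_triangle_ineq) auto
      also have "\<dots> \<le> 2 * (norm (s *\<^sub>R f x))\<^sup>2 + 2 * (norm (t *\<^sub>R g x))\<^sup>2"
        using sum_squares_bound[of "norm (s *\<^sub>R f x)" "norm (t *\<^sub>R g x)"]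
        unfolding power2_sum by linarith
      finally show ?thesis by (simp add: power_mult_distrib)
    qed
    then show "AE x in M. norm ((norm (s *\<^sub>R f x + t *\<^sub>R g x))\<^sup>2) \<le>
        norm (2 * s\<^sup>2 * (norm (f x))\<^sup>2 + 2 * t\<^sup>2 * (norm (g x))\<^sup>2)"
      by (intro AE_I2) auto
  qed measurable
  then show ?thesis unfolding square_integrable_def by simp
qed

lemma W_space_lincomb:
  assumes "u \<in> W_space \<Omega> T k" "w \<in> W_space \<Omega> T k"
  shows "(\<lambda>x. s * u x + t * w x) \<in> W_space \<Omega> T k"
  unfolding W_space_def mem_Collect_eq
proof (intro conjI ballI)
  show "square_integrable (lebesgue_on \<Omega>) (\<lambda>x. s * u x + t * w x)"
    using square_integrable_lincomb[of _ u w s t] assms unfolding W_space_def by simp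
  fix K assume "K \<in> T"
  then obtain p q where p: "p \<in> poly_space k" "AE x in lebesgue_on K. u x = p x"
    and q: "q \<in> poly_space k" "AE x in lebesgue_on K. w x = q x"
    using assms unfolding W_space_def by blast
  have "AE x in lebesgue_on K. s * u x + t * w x = s * p x + t * q x"
    using p(2) q(2) by eventually_elim simp
  with poly_space_lincomb[OF p(1) q(1)]
  show "\<exists>r\<in>poly_space k. AE x in lebesgue_on K. s * u x + t * w x = r x"
    by (intro bexI[where x = "\<lambda>x. s * p x + t * q x"])
qed

lemma V_space_lincomb:
  assumes "u \<in> V_space \<Omega> T k" "w \<in> V_space \<Omega> T k"
  shows "(\<lambda>x. s *\<^sub>R u x + t *\<^sub>R w x) \<in> V_space \<Omega> T k"
  unfolding V_space_def mem_Collect_eq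
proof (intro conjI ballI)
  show "square_integrable (lebesgue_on \<Omega>) (\<lambda>x. s *\<^sub>R u x + t *\<^sub>R w x)"
    using square_integrable_lincomb[of _ u w s t] assms unfolding V_space_def by simp
  fix K assume "K \<in> T"
  then obtain p q where p: "\<And>i. (\<lambda>x. p x $ i) \<in> poly_space k" "AE x in lebesgue_on K. u x = p x"
    and q: "\<And>i. (\<lambda>x. q x $ i) \<in> poly_space k" "AE x in lebesgue_on K. w x = q x"
    using assms unfolding V_space_def by blast
  have "AE x in lebesgue_on K. s *\<^sub>R u x + t *\<^sub>R w x = s *\<^sub>R p x + t *\<^sub>R q x"
    using p(2) q(2) by eventually_elim simp
  with poly_space_lincomb[OF p(1) q(1)]
  show "\<exists>r. (\<forall>i. (\<lambda>x. r x $ i) \<in> poly_space k) \<and> (AE x in lebesgue_on K. s *\<^sub>R u x + t *\<^sub>R w x = r x)"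
    by (intro exI[where x = "\<lambda>x. s *\<^sub>R p x + t *\<^sub>R q x"]) simp
qed

lemma M_space_lincomb:
  assumes "u \<in> M_space T k" "w \<in> M_space T k"
  shows "(\<lambda>x. s * u x + t * w x) \<in> M_space T k"
  unfolding M_space_def mem_Collect_eq
proof (intro conjI ballI)
  fix E assume E: "E \<in> mesh_edges T"
  show "square_integrable (edge_measure E) (\<lambda>x. s * u x + t * w x)"
    using square_integrable_lincomb[of _ u w s t] assms E unfolding M_space_def by simp
  obtain p q where p: "p \<in> poly_space k" "AE x in edge_measure E. u x = p x"
    and q: "q \<in> poly_space k" "AE x in edge_measure E. w x = q x"
    using assms E unfolding M_space_def by blast
  have "AE x in edge_measure E. s * u x + t * w x = s * p x + t * q x"
    using p(2) q(2) by eventually_elim simp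
  with poly_space_lincomb[OF p(1) q(1)]
  show "\<exists>r\<in>poly_space k. AE x in edge_measure E. s * u x + t * w x = r x"
    by (intro bexI[where x = "\<lambda>x. s * p x + t * q x"])
qed

lemma W_space_piece:
  assumes "w \<in> W_space \<Omega> T k" "K \<in> T"
  shows "polynomial_function (piece K w)" "AE x in lebesgue_on K. w x = piece K w x"
proof -
  obtain p where "p \<in> poly_space k" "AE x in lebesgue_on K. w x = p x"
    using assms unfolding W_space_def by blast
  then show "polynomial_function (piece K w)" "AE x in lebesgue_on K. w x = piece K w x"
    using piece_works[of p w K] poly_space_polynomial[of p k] by
        (simp_all add: real_polynomial_function_eq)
qed

lemma V_space_piece:
  assumes "v \<in> V_space \<Omega> T k" "K \<in> T"
  shows "polynomial_function (piece K v)" "AE x in lebesgue_on K. v x = piece K v x"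
proof -
  obtain p where p: "\<And>i. (\<lambda>x. p x $ i) \<in> poly_space k" "AE x in lebesgue_on K. v x = p x"
    using assms unfolding V_space_def by blast
  have "polynomial_function p"
    unfolding polynomial_function_iff_Basis_inner
    using p(1) poly_space_polynomial by (auto simp: Basis_vec_def inner_axis)
  then show "polynomial_function (piece K v)" "AE x in lebesgue_on K. v x = piece K v x"
    using piece_works[of p v K] p(2) by simp_all
qed

section \<open>Assembling cells and edges\<close>

text \<open>Distinct cells meet in a proper face of at least one of them, which has lower dimension and is
  therefore null; the boundary of the convex set \<open>\<Omega>\<close> is null as well. Nonnegativity of \<open>g\<close> turns the
  resulting gauge integral over \<open>\<Omega>\<close> into a Lebesgue integral.\<close>

lemma integral_Union_cells:
  fixes g :: "real^2 \<Rightarrow> real"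
  assumes T: "triangulation_of T \<Omega>" and \<Omega>: "convex_polygonal_domain \<Omega>"
    and g: "\<And>K. K \<in> T \<Longrightarrow> essentially_continuous (lebesgue_on K) g" and pos: "\<And>x. 0 \<le> g x"
  shows "(LINT x|lebesgue_on \<Omega>. g x) = (\<Sum>K\<in>T. LINT x|lebesgue_on K. g x)"
proof -
  have fin: "finite T" and cells: "\<And>K. K \<in> T \<Longrightarrow> 2 simplex K" and un: "\<Union>T = closure \<Omega>"
    and face: "\<And>K L. K \<in> T \<Longrightarrow> L \<in> T \<Longrightarrow> (K \<inter> L) face_of K"
    using T unfolding triangulation_of_def triangulation_def by auto
  have op: "open \<Omega>" and cv: "convex \<Omega>" using \<Omega> unfolding convex_polygonal_domain_def by auto
  have "(g has_integral (\<Sum>K\<in>T. LINT x|lebesgue_on K. g x)) (\<Union>T)"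
  proof (rule has_integral_Union[OF fin])
    fix K assume K: "K \<in> T"
    have "K \<in> sets lebesgue"
      using two_simplex_compact[OF cells[OF K]] by (simp add: borel_compact sets_completionI_sets)
    then show "(g has_integral (LINT x|lebesgue_on K. g x)) K"
      by (intro has_integral_integral_lebesgue_on essentially_continuous_integrable g K
          integrates_continuous_lebesgue_on two_simplex_compact cells)
  next
    show "pairwise (\<lambda>S S'. negligible (S \<inter> S')) T"
    proof (rule pairwiseI)
      fix K L assume KL: "K \<in> T" "L \<in> T" "K \<noteq> L"
      have conv: "convex K" "convex L" using cells KL by (auto simp: simplex convex_convex_hull)
      have dim: "aff_dim K = 2" "aff_dim L = 2" using cells KL aff_dim_simplex by auto
      have "K \<inter> L \<noteq> K \<or> K \<inter> L \<noteq> L" using KL by auto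
      then have "aff_dim (K \<inter> L) < 2"
        using face_of_aff_dim_lt[OF conv(1) face[OF KL(1,2)]] face_of_aff_dim_lt[OF conv(2) face[OF
            KL(2,1)]] dim
        by (auto simp: Int_commute)
      then have "interior (K \<inter> L) = {}"
        using aff_dim_nonempty_interior[of "K \<inter> L"] by auto
      then show "negligible (K \<inter> L)"
        using negligible_convex_interior[OF convex_Int[OF conv]] by blast
    qed
  qed
  then have "(g has_integral (\<Sum>K\<in>T. LINT x|lebesgue_on K. g x)) \<Omega>"
    unfolding un
  proof (subst has_integral_spike_set_eq)
    have "negligible (frontier \<Omega>)" using cv by (rule negligible_convex_frontier)
    then show "negligible {x \<in> closure \<Omega> - \<Omega>. g x \<noteq> 0}"
      by (rule negligible_subset) (use op in \<open>auto simp: frontier_def interior_open\<close>)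
    show "negligible {x \<in> \<Omega> - closure \<Omega>. g x \<noteq> 0}"
      using closure_subset[of \<Omega>] by (simp add: Diff_eq_empty_iff[THEN iffD2])
  qed
  moreover have "\<Omega> \<in> sets lebesgue" using op by (simp add: borel_open sets_completionI_sets)
  ultimately have int: "g integrable_on \<Omega>" and val: "integral \<Omega> g = (\<Sum>K\<in>T. LINT x|lebesgue_on K. g x)"
    and \<Omega>l: "\<Omega> \<in> sets lebesgue"
    by (auto simp: integral_unique has_integral_integrable)
  have "g absolutely_integrable_on \<Omega>"
    using int pos by (intro nonnegative_absolutely_integrable_1) auto
  then have "integrable (lebesgue_on \<Omega>) g"
    using \<Omega>l by (rule absolutely_integrable_imp_integrable)
  then show ?thesis
    using \<Omega>l val by (simp add: lebesgue_integral_eq_integral)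
qed

lemma triangle_facets:
  assumes K: "2 simplex (K :: (real^2) set)"
  shows "finite {E. E facet_of K}" and "\<And>E. E facet_of K \<Longrightarrow> \<exists>a b. E = closed_segment a b"
proof -
  from two_simplex_vertices[OF K] obtain a b c where Kabc: "K = convex hull {a,b,c}" and
    pos: "cross2 (b-a) (c-a) > 0" and ind: "\<not> affine_dependent {a,b,c}" .
  have "a \<noteq> b" "b \<noteq> c" "a \<noteq> c" using pos by (auto simp: cross2_def)
  from facets_triangle[OF ind this]
  have *: "{E. E facet_of K} = {closed_segment a b, closed_segment b c, closed_segment c a}"
      unfolding Kabc .
  show "finite {E. E facet_of K}" unfolding * by simp
  show "\<exists>a b. E = closed_segment a b" if "E facet_of K" for E using that * by blast
qed

lemma facet_measure:
  assumes "2 simplex (K :: (real^2) set)" "E facet_of K"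
  shows "integrates_continuous (edge_measure E)" "AE x in edge_measure E. x \<in> K"
proof -
  obtain a b where ab: "E = closed_segment a b" using triangle_facets(2)[OF assms] by blast
  show "integrates_continuous (edge_measure E)" unfolding ab
      by (rule integrates_continuous_edge_measure)
  have "AE x in edge_measure E. x \<in> E" unfolding ab by (rule AE_edge_measure)
  then show "AE x in edge_measure E. x \<in> K"
    by eventually_elim (use facet_of_imp_subset[OF assms(2)] in auto)
qed

text \<open>Linearity of \<open>piece\<close> on the cell is a consequence of uniqueness, and holds up to the
  boundary, which the edge terms require.\<close>

lemma piece_W_lincomb:
  assumes K: "2 simplex K" "K \<in> T" and u: "u \<in> W_space \<Omega> T k" and w: "w \<in> W_space \<Omega> T k" and x: "x \<in> K"
  shows "piece K (\<lambda>x. s * u x + t * w x) x = s * piece K u x + t * piece K w x"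
proof (rule AE_eq_continuous_on_cell[OF K(1) _ _ _ x])
  note pu = W_space_piece[OF u K(2)] and pw = W_space_piece[OF w K(2)]
    and ps = W_space_piece[OF W_space_lincomb[OF u w, of s t] K(2)]
  show "continuous_on UNIV (piece K (\<lambda>x. s * u x + t * w x))"
    using ps(1) by (rule continuous_on_polymonial_function)
  show "continuous_on UNIV (\<lambda>x. s * piece K u x + t * piece K w x)"
    using pu(1) pw(1) by (intro continuous_intros continuous_on_polymonial_function)
  show "AE x in lebesgue_on K. piece K (\<lambda>x. s * u x + t * w x) x = s * piece K u x + t * piece K w x"
    using pu(2) pw(2) ps(2) by eventually_elim simp
qed

lemma piece_V_lincomb:
  assumes K: "2 simplex K" "K \<in> T" and u: "u \<in> V_space \<Omega> T k" and w: "w \<in> V_space \<Omega> T k" and x: "x \<in> K"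
  shows "piece K (\<lambda>x. s *\<^sub>R u x + t *\<^sub>R w x) x = s *\<^sub>R piece K u x + t *\<^sub>R piece K w x"
proof (rule AE_eq_continuous_on_cell[OF K(1) _ _ _ x])
  note pu = V_space_piece[OF u K(2)] and pw = V_space_piece[OF w K(2)]
    and ps = V_space_piece[OF V_space_lincomb[OF u w, of s t] K(2)]
  show "continuous_on UNIV (piece K (\<lambda>x. s *\<^sub>R u x + t *\<^sub>R w x))"
    using ps(1) by (rule continuous_on_polymonial_function)
  show "continuous_on UNIV (\<lambda>x. s *\<^sub>R piece K u x + t *\<^sub>R piece K w x)"
    using pu(1) pw(1) by (intro continuous_intros continuous_on_polymonial_function)
  show "AE x in lebesgue_on K. piece K (\<lambda>x. s *\<^sub>R u x + t *\<^sub>R w x) x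
      = s *\<^sub>R piece K u x + t *\<^sub>R piece K w x"
    using pu(2) pw(2) ps(2) by eventually_elim simp
qed

lemma W_space_essentially_continuous:
  assumes "w \<in> W_space \<Omega> T k" "K \<in> T"
  shows "essentially_continuous (lebesgue_on K) w"
  using W_space_piece[OF assms] by (intro essentially_continuous_AE continuous_on_polymonial_function)

lemma V_space_essentially_continuous:
  assumes "v \<in> V_space \<Omega> T k" "K \<in> T"
  shows "essentially_continuous (lebesgue_on K) v"
  using V_space_piece[OF assms] by (intro essentially_continuous_AE continuous_on_polymonial_function)

lemma M_space_essentially_continuous:
  assumes "\<mu> \<in> M_space T k" "E \<in> mesh_edges T"
  shows "essentially_continuous (edge_measure E) \<mu>"
proof -
  obtain p where "p \<in> poly_space k" "AE x in edge_measure E. \<mu> x = p x"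
    using assms unfolding M_space_def by blast
  then show ?thesis
    using poly_space_polynomial[of p k] 
    by (intro essentially_continuous_AE[of p]) (simp_all add: real_polynomial_function_eq
        continuous_on_polymonial_function)
qed

text \<open>In the volume integrals each class may be replaced by its polynomial on the cell; the boundary
  terms involve the polynomial by definition.\<close>

lemma discrete_green:
  assumes cells: "\<And>K. K \<in> T \<Longrightarrow> 2 simplex K" and w: "w \<in> W_space \<Omega> T k" and v: "v \<in> V_space \<Omega> T k"
  shows "vol_pair T (\<lambda>K. w) (\<lambda>K. divergence (piece K v)) + vol_pair T (\<lambda>K. v) (\<lambda>K. grad (piece K w)) =
    bd_pair T (\<lambda>K E. piece K w) (\<lambda>K E x. piece K v x \<bullet> outward_normal K E)"
  unfolding vol_pair_def bd_pair_def sum.distrib[symmetric]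
proof (rule sum.cong[OF refl])
  fix K assume K: "K \<in> T"
  have M: "integrates_continuous (lebesgue_on K)"
    using cells[OF K] two_simplex_compact integrates_continuous_lebesgue_on by blast
  note pw = W_space_piece[OF w K] and pv = V_space_piece[OF v K]
  have "(LINT x|lebesgue_on K. w x \<bullet> divergence (piece K v) x) =
      (LINT x|lebesgue_on K. piece K w x * divergence (piece K v) x)"
  proof (rule integral_AE_eq[OF M])
    show "AE x in lebesgue_on K. w x \<bullet> divergence (piece K v) x
        = piece K w x * divergence (piece K v) x"
      using pw(2) by eventually_elim simp
    show "essentially_continuous (lebesgue_on K) (\<lambda>x. piece K w x * divergence (piece K v) x)"
      by (intro essentially_continuous_continuous continuous_intros continuous_divergence
          continuous_on_polymonial_function pw pv)
  qed
  moreover have "(LINT x|lebesgue_on K. v x \<bullet> grad (piece K w) x) =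
      (LINT x|lebesgue_on K. piece K v x \<bullet> grad (piece K w) x)"
  proof (rule integral_AE_eq[OF M])
    show "AE x in lebesgue_on K. v x \<bullet> grad (piece K w) x = piece K v x \<bullet> grad (piece K w) x"
      using pv(2) by eventually_elim simp
    show "essentially_continuous (lebesgue_on K) (\<lambda>x. piece K v x \<bullet> grad (piece K w) x)"
      by (intro essentially_continuous_continuous continuous_intros continuous_grad
          continuous_on_polymonial_function pw pv)
  qed
  ultimately show "(LINT x|lebesgue_on K. w x \<bullet> divergence (piece K v) x) +
         (LINT x|lebesgue_on K. v x \<bullet> grad (piece K w) x) =
         (\<Sum>E | E facet_of K. LINT x|edge_measure E. piece K w x * (piece K v x \<bullet> outward_normal K E))"
    using green_triangle[OF cells[OF K] pw(1) pv(1)] by simp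
qed

text \<open>Expresses the norms over \<open>\<Omega>\<close> in the energy by the cell sums in which the scheme is written.\<close>

lemma l2norm_sq_cells:
  fixes f :: "real^2 \<Rightarrow> 'b::euclidean_space"
  assumes "triangulation_of T \<Omega>" "convex_polygonal_domain \<Omega>"
    and f: "\<And>K. K \<in> T \<Longrightarrow> essentially_continuous (lebesgue_on K) f"
  shows "(l2norm (lebesgue_on \<Omega>) f)\<^sup>2 = (\<Sum>K\<in>T. LINT x|lebesgue_on K. f x \<bullet> f x)"
proof -
  have "(l2norm (lebesgue_on \<Omega>) f)\<^sup>2 = (LINT x|lebesgue_on \<Omega>. f x \<bullet> f x)"
    unfolding l2norm_def by (simp add: power2_norm_eq_inner Bochner_Integration.integral_nonneg)
  also have "\<dots> = (\<Sum>K\<in>T. LINT x|lebesgue_on K. f x \<bullet> f x)"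
    using f by (intro integral_Union_cells[OF assms(1,2)] essentially_continuous_inner) auto
  finally show ?thesis .
qed

lemma plus_norm_sq:
  assumes \<tau>: "\<And>E. E \<in> mesh_edges T \<Longrightarrow> 0 < \<tau> E"
  shows "(plus_norm T \<tau> \<psi> \<psi>h)\<^sup>2 =
    (\<Sum>K\<in>T. \<Sum>E | E facet_of K. LINT x|edge_measure E. \<tau> E * (piece K \<psi> x - \<psi>h x)\<^sup>2)"
proof -
  have "(plus_norm T \<tau> \<psi> \<psi>h)\<^sup>2 = (\<Sum>K\<in>T. \<Sum>E | E facet_of K.
       (l2norm (edge_measure E) (\<lambda>x. sqrt (\<tau> E) * (piece K \<psi> x - \<psi>h x)))\<^sup>2)"
    unfolding plus_norm_def by (intro real_sqrt_pow2 sum_nonneg) simp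
  also have "\<dots> = (\<Sum>K\<in>T. \<Sum>E | E facet_of K. LINT x|edge_measure E. \<tau> E * (piece K \<psi> x - \<psi>h x)\<^sup>2)"
  proof (intro sum.cong refl)
    fix K E assume "K \<in> T" "E \<in> {E. E facet_of K}"
    then have "\<tau> E \<ge> 0" using \<tau>[of E] unfolding mesh_edges_def by force
    then show "(l2norm (edge_measure E) (\<lambda>x. sqrt (\<tau> E) * (piece K \<psi> x - \<psi>h x)))\<^sup>2 =
        (LINT x|edge_measure E. \<tau> E * (piece K \<psi> x - \<psi>h x)\<^sup>2)"
      unfolding l2norm_def by (simp add: power_mult_distrib)
  qed
  finally show ?thesis .
qed

section \<open>Balance of energy between two time levels\<close>

locale hdg_solution =
  fixes \<Omega> :: "(real^2) set" and T :: "(real^2) set set" and k :: nat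
    and \<tau> :: "(real^2) set \<Rightarrow> real" and \<Delta>t :: real
    and U :: "nat \<Rightarrow> real^2 \<Rightarrow> real" and Q :: "nat \<Rightarrow> real^2 \<Rightarrow> real^2"
    and Uh :: "nat \<Rightarrow> real^2 \<Rightarrow> real"
  assumes domain: "convex_polygonal_domain \<Omega>"
    and mesh: "triangulation_of T \<Omega>"
    and tau_pos: "\<And>E. E \<in> mesh_edges T \<Longrightarrow> \<tau> E > 0"
    and step_pos: "\<Delta>t > 0"
    and U_space: "\<And>m. U m \<in> W_space \<Omega> T k"
    and Q_space: "\<And>m. Q m \<in> V_space \<Omega> T k"
    and Uh_space: "\<And>m. Uh m \<in> M_space T k"
    and scheme: "hdg_scheme \<Omega> T k \<tau> \<Delta>t U Q Uh"
begin

lemma cells: "K \<in> T \<Longrightarrow> 2 simplex K"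
  using mesh unfolding triangulation_of_def by blast

lemma cell_measure: "K \<in> T \<Longrightarrow> integrates_continuous (lebesgue_on K)"
  using cells two_simplex_compact integrates_continuous_lebesgue_on by blast

lemma finite_mesh: "finite T"
  using mesh unfolding triangulation_of_def triangulation_def by blast

lemma facet_mesh_edge: "K \<in> T \<Longrightarrow> E facet_of K \<Longrightarrow> E \<in> mesh_edges T"
  unfolding mesh_edges_def by blast

lemma ess_U: "K \<in> T \<Longrightarrow> essentially_continuous (lebesgue_on K) (U m)"
  using W_space_essentially_continuous U_space by blast

lemma ess_Q: "K \<in> T \<Longrightarrow> essentially_continuous (lebesgue_on K) (Q m)"
  using V_space_essentially_continuous Q_space by blast

lemma ess_Uh: "E \<in> mesh_edges T \<Longrightarrow> essentially_continuous (edge_measure E) (Uh m)"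
  using M_space_essentially_continuous Uh_space by blast

lemma ess_piece_U: "K \<in> T \<Longrightarrow> essentially_continuous M (piece K (U m))"
  by (intro essentially_continuous_continuous continuous_on_polymonial_function W_space_piece(1)[OF
      U_space])

lemma ess_piece_Q: "K \<in> T \<Longrightarrow> essentially_continuous M (piece K (Q m))"
  by (intro essentially_continuous_continuous continuous_on_polymonial_function V_space_piece(1)[OF
      Q_space])

text \<open>The test function of the wave equation, the corresponding difference of traces, and the
  test function of the flux equation. They are used for \<open>n \<ge> 1\<close>, where \<open>n - 1\<close> is not truncated.\<close>

definition U_diff :: "nat \<Rightarrow> real^2 \<Rightarrow> real" where "U_diff n x = U (n + 1) x - U (n - 1) x"
definition Uh_diff :: "nat \<Rightarrow> real^2 \<Rightarrow> real" where "Uh_diff n x = Uh (n + 1) x - Uh (n - 1) x"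
definition Q_avg :: "nat \<Rightarrow> real^2 \<Rightarrow> real^2" where "Q_avg n x = avg (\<lambda>m. Q m x) n"

lemma U_diff_W: "U_diff n \<in> W_space \<Omega> T k"
  using W_space_lincomb[OF U_space U_space, of 1 "n+1" "-1" "n-1"] by (simp add: U_diff_def[abs_def])

lemma Uh_diff_M: "Uh_diff n \<in> M_space T k"
  using M_space_lincomb[OF Uh_space Uh_space, of 1 "n+1" "-1" "n-1"] by (simp add: Uh_diff_def[abs_def])

lemma Q_avg_V: "Q_avg n \<in> V_space \<Omega> T k"
  using V_space_lincomb[OF Q_space Q_space, of "1/2" "n+1" "1/2" "n-1"]
  by (simp add: Q_avg_def[abs_def] avg_def scaleR_add_right)

lemma piece_U_diff: "K \<in> T \<Longrightarrow> x \<in> K \<Longrightarrow> piece K (U_diff n) x = piece K (U (n+1)) x - piece K (U (n-1)) x"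
  using piece_W_lincomb[OF cells _ U_space U_space, of K x 1 "n+1" "-1" "n-1"] by
      (simp add: U_diff_def[abs_def])

lemma piece_Q_avg: "K \<in> T \<Longrightarrow> x \<in> K \<Longrightarrow>
    piece K (Q_avg n) x = (1/2) *\<^sub>R (piece K (Q (n+1)) x + piece K (Q (n-1)) x)"
  using piece_V_lincomb[OF cells _ Q_space Q_space, of K x "1/2" "n+1" "1/2" "n-1"]
  by (simp add: Q_avg_def[abs_def] avg_def scaleR_add_right)

text \<open>With \<open>a\<close> and \<open>b\<close> the increments of \<open>U\<close> after and before the level \<open>n\<close>, the integrand is
  \<open>(a - b)(a + b) / \<Delta>t\<^sup>2\<close>.\<close>

lemma kinetic_balance:
  assumes "n \<ge> 1"
  shows "vol_pair T (\<lambda>K x. dtt \<Delta>t (\<lambda>m. U m x) n) (\<lambda>K. U_diff n) =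
    (l2norm (lebesgue_on \<Omega>) (\<lambda>x. dt \<Delta>t (\<lambda>m. U m x) n))\<^sup>2
    - (l2norm (lebesgue_on \<Omega>) (\<lambda>x. dt \<Delta>t (\<lambda>m. U m x) (n - 1)))\<^sup>2"
proof -
  have ess: "essentially_continuous (lebesgue_on K) (\<lambda>x. dt \<Delta>t (\<lambda>m. U m x) m)" if "K \<in> T" for K m
    unfolding dt_def using that by (intro ess_cont ess_U)
  have norm_sq: "(l2norm (lebesgue_on \<Omega>) (\<lambda>x. dt \<Delta>t (\<lambda>m. U m x) m))\<^sup>2 =
      (\<Sum>K\<in>T. LINT x|lebesgue_on K. dt \<Delta>t (\<lambda>m. U m x) m \<bullet> dt \<Delta>t (\<lambda>m. U m x) m)" for m
    by (rule l2norm_sq_cells[OF mesh domain ess])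
  show ?thesis
    unfolding vol_pair_def norm_sq sum_subtractf[symmetric]
  proof (rule sum.cong[OF refl])
    fix K assume K: "K \<in> T"
    let ?d = "\<lambda>m x. dt \<Delta>t (\<lambda>m. U m x) m"
    have pt: "dtt \<Delta>t (\<lambda>m. U m x) n \<bullet> U_diff n x = ?d n x \<bullet> ?d n x - ?d (n-1) x \<bullet> ?d (n-1) x" for x
      using assms step_pos by (simp add: dtt_def dt_def U_diff_def field_simps power2_eq_square)
    show "(LINT x|lebesgue_on K. dtt \<Delta>t (\<lambda>m. U m x) n \<bullet> U_diff n x) =
       (LINT x|lebesgue_on K. ?d n x \<bullet> ?d n x) - (LINT x|lebesgue_on K. ?d (n-1) x \<bullet> ?d (n-1) x)"
      unfolding pt using K ess
      by (intro Bochner_Integration.integral_diff essentially_continuous_integrable cell_measure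
          essentially_continuous_inner) auto
  qed
qed

text \<open>The quotient multiplied by its denominator is the difference of the potentials; where the
  denominator vanishes both sides are zero.\<close>

lemma potential_balance:
  "vol_pair T (\<lambda>K x. F_quot (U (n + 1) x) (U (n - 1) x)) (\<lambda>K. U_diff n) =
    vol_pair T (\<lambda>K x. F_pot (U (n + 1) x)) (\<lambda>K x. 1) - vol_pair T (\<lambda>K x. F_pot (U (n - 1) x)) (\<lambda>K x. 1)"
  unfolding vol_pair_def sum_subtractf[symmetric]
proof (rule sum.cong[OF refl])
  fix K assume K: "K \<in> T"
  have ess: "essentially_continuous (lebesgue_on K) (\<lambda>x. F_pot (U m x))" for m
    unfolding F_pot_def using K by (intro ess_cont ess_U)
  have pt: "F_quot (U (n + 1) x) (U (n - 1) x) \<bullet> U_diff n x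
      = F_pot (U (n + 1) x) \<bullet> 1 - F_pot (U (n - 1) x) \<bullet> 1" for x
    by (simp add: F_quot_def U_diff_def)
  show "(LINT x|lebesgue_on K. F_quot (U (n + 1) x) (U (n - 1) x) \<bullet> U_diff n x) =
     (LINT x|lebesgue_on K. F_pot (U (n + 1) x) \<bullet> 1) - (LINT x|lebesgue_on K. F_pot (U (n - 1) x) \<bullet> 1)"
    unfolding pt using K ess
    by (intro Bochner_Integration.integral_diff essentially_continuous_integrable cell_measure) auto
qed

lemma Q_norm_sq: "(l2norm (lebesgue_on \<Omega>) (Q m))\<^sup>2 = (\<Sum>K\<in>T. LINT x|lebesgue_on K. Q m x \<bullet> Q m x)"
  by (rule l2norm_sq_cells[OF mesh domain ess_Q])

text \<open>The identity \<open>(a - b) \<bullet> (a + b) = \<bar>a\<bar>\<^sup>2 - \<bar>b\<bar>\<^sup>2\<close> under the integral, halved because \<open>Q_avg\<close>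
  is an average.\<close>

lemma flux_norm_balance:
  "vol_pair T (\<lambda>K. Q (n + 1)) (\<lambda>K. Q_avg n) - vol_pair T (\<lambda>K. Q (n - 1)) (\<lambda>K. Q_avg n) =
    1/2 * ((l2norm (lebesgue_on \<Omega>) (Q (n + 1)))\<^sup>2 - (l2norm (lebesgue_on \<Omega>) (Q (n - 1)))\<^sup>2)"
  unfolding vol_pair_def Q_norm_sq sum_subtractf[symmetric] sum_distrib_left
proof (rule sum.cong[OF refl])
  fix K assume K: "K \<in> T"
  have int: "integrable (lebesgue_on K) (\<lambda>x. Q i x \<bullet> Q j x)" for i j
    using K by (intro essentially_continuous_integrable cell_measure essentially_continuous_inner ess_Q)
  have pt: "Q m x \<bullet> Q_avg n x = 1/2 * (Q m x \<bullet> Q (n+1) x) + 1/2 * (Q m x \<bullet> Q (n-1) x)" for m x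
    by (simp add: Q_avg_def avg_def inner_add_right)
  have "(LINT x|lebesgue_on K. Q m x \<bullet> Q_avg n x) =
     1/2 * (LINT x|lebesgue_on K. Q m x \<bullet> Q (n+1) x) + 1/2 * (LINT x|lebesgue_on K. Q m x \<bullet> Q (n-1)
         x)" for m
    unfolding pt using int by simp
  moreover have "(LINT x|lebesgue_on K. Q (n - 1) x \<bullet> Q (n + 1) x)
      = (LINT x|lebesgue_on K. Q (n + 1) x \<bullet> Q (n - 1) x)"
    by (intro Bochner_Integration.integral_cong refl inner_commute)
  ultimately show "(LINT x|lebesgue_on K. Q (n + 1) x \<bullet> Q_avg n x) - (LINT x|lebesgue_on K. Q (n -
      1) x \<bullet> Q_avg n x) =
     1/2 * ((LINT x|lebesgue_on K. Q (n + 1) x \<bullet> Q (n + 1) x) - (LINT x|lebesgue_on K. Q (n - 1) x \<bullet>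
         Q (n - 1) x))"
    by simp
qed

definition avg_flux :: "nat \<Rightarrow> (real^2) set \<Rightarrow> (real^2) set \<Rightarrow> real^2 \<Rightarrow> real" where
  "avg_flux n K E x = avg (\<lambda>m. num_flux \<tau> (U m) (Q m) (Uh m) K E x) n"

lemma ess_num_flux:
  assumes "K \<in> T" "E facet_of K"
  shows "essentially_continuous (edge_measure E) (num_flux \<tau> (U m) (Q m) (Uh m) K E)"
  unfolding num_flux_def[abs_def] using facet_mesh_edge[OF assms] assms
  by (intro ess_cont ess_piece_Q ess_piece_U ess_Uh)

lemma avg_flux_eq: "avg_flux n K E x = 1/2 * num_flux \<tau> (U (n+1)) (Q (n+1)) (Uh (n+1)) K E x
     + 1/2 * num_flux \<tau> (U (n-1)) (Q (n-1)) (Uh (n-1)) K E x"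
  by (simp add: avg_flux_def avg_def)

lemma ess_avg_flux:
  assumes "K \<in> T" "E facet_of K"
  shows "essentially_continuous (edge_measure E) (avg_flux n K E)"
  unfolding avg_flux_eq[abs_def] using assms by (intro ess_cont ess_num_flux)

text \<open>The trace is itself an admissible test function in the boundary equation, which then says that a
  sum of integrals of squares vanishes.\<close>

lemma Uh_boundary_zero:
  assumes "E \<in> boundary_edges \<Omega> T"
  shows "AE x in edge_measure E. Uh m x = 0"
proof -
  have fin: "finite (boundary_edges \<Omega> T)"
  proof -
    have "mesh_edges T = (\<Union>K\<in>T. {E. E facet_of K})" unfolding mesh_edges_def by auto
    then have "finite (mesh_edges T)" using finite_mesh triangle_facets(1) cells by simp
    then show ?thesis unfolding boundary_edges_def by simp
  qed
  have "outer_bd_pair \<Omega> T (Uh m) (Uh m) = 0"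
    using scheme Uh_space unfolding hdg_scheme_def by blast
  then have "(\<Sum>E\<in>boundary_edges \<Omega> T. LINT x|edge_measure E. Uh m x * Uh m x) = 0"
    unfolding outer_bd_pair_def .
  then have z: "(LINT x|edge_measure E. Uh m x * Uh m x) = 0"
    using assms fin by (subst (asm) sum_nonneg_eq_0_iff)
        (auto intro!: Bochner_Integration.integral_nonneg)
  have E: "E \<in> mesh_edges T" using assms unfolding boundary_edges_def by blast
  then obtain K where K: "K \<in> T" "E facet_of K" unfolding mesh_edges_def by blast
  have "integrable (edge_measure E) (\<lambda>x. Uh m x * Uh m x)"
    by (intro essentially_continuous_integrable facet_measure[OF cells[OF K(1)] K(2)]
        essentially_continuous_mult ess_Uh E)
  then have "AE x in edge_measure E. Uh m x * Uh m x = 0"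
    using z by (subst (asm) integral_nonneg_eq_0_iff_AE) auto
  then show ?thesis by simp
qed

text \<open>On interior edges this is the continuity equation of the numerical flux, tested with the
  difference of traces, at the two levels that are averaged. The other edges lie on the boundary,
  where the traces vanish.\<close>

lemma avg_flux_Uh_diff: "bd_pair T (avg_flux n) (\<lambda>K E. Uh_diff n) = 0"
proof -
  have int: "integrable (edge_measure E) (\<lambda>x. num_flux \<tau> (U m) (Q m) (Uh m) K E x * Uh_diff n x)"
      if "K \<in> T" "E facet_of K" for K E m
    using that by (intro essentially_continuous_integrable facet_measure(1)[OF cells]
        essentially_continuous_mult ess_num_flux
      M_space_essentially_continuous[OF Uh_diff_M] facet_mesh_edge)
  have split: "(LINT x|edge_measure E. avg_flux n K E x * Uh_diff n x) =
     1/2 * (LINT x|edge_measure E. num_flux \<tau> (U (n+1)) (Q (n+1)) (Uh (n+1)) K E x * Uh_diff n x)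
     + 1/2 * (LINT x|edge_measure E. num_flux \<tau> (U (n-1)) (Q (n-1)) (Uh (n-1)) K E x * Uh_diff n x)" 
     if "K \<in> T" "E facet_of K" for K E
    unfolding avg_flux_eq using int[OF that] by (simp add: distrib_right)
  have bdry: "(LINT x|edge_measure E. avg_flux n K E x * Uh_diff n x) = 0"
      if "K \<in> T" "E facet_of K" "E \<subseteq> frontier \<Omega>" for K E
  proof -
    have "E \<in> boundary_edges \<Omega> T" using that facet_mesh_edge unfolding boundary_edges_def by blast
    then have "AE x in edge_measure E. Uh (n+1) x = 0" "AE x in edge_measure E. Uh (n-1) x = 0"
      by (rule Uh_boundary_zero)+
    then have "AE x in edge_measure E. avg_flux n K E x * Uh_diff n x = 0"
      by eventually_elim (simp add: Uh_diff_def)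
    then show ?thesis by (rule integral_eq_zero_AE)
  qed
  have zero: "interior_bd_pair \<Omega> T (num_flux \<tau> (U m) (Q m) (Uh m)) (\<lambda>K E. Uh_diff n) = 0" for m
    using scheme Uh_diff_M unfolding hdg_scheme_def by blast
  have "bd_pair T (avg_flux n) (\<lambda>K E. Uh_diff n) =
    (\<Sum>K\<in>T. \<Sum>E | E facet_of K \<and> \<not> E \<subseteq> frontier \<Omega>. LINT x|edge_measure E. avg_flux n K E x * Uh_diff n x)"
    unfolding bd_pair_def
    using bdry by (intro sum.cong refl sum.mono_neutral_right triangle_facets(1) cells) auto
  also have "\<dots> = (\<Sum>K\<in>T. \<Sum>E | E facet_of K \<and> \<not> E \<subseteq> frontier \<Omega>.
      1/2 * (LINT x|edge_measure E. num_flux \<tau> (U (n+1)) (Q (n+1)) (Uh (n+1)) K E x * Uh_diff n x)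
     + 1/2 * (LINT x|edge_measure E. num_flux \<tau> (U (n-1)) (Q (n-1)) (Uh (n-1)) K E x * Uh_diff n x))"
    using split by (intro sum.cong refl) auto
  also have "\<dots> = 1/2 * interior_bd_pair \<Omega> T (num_flux \<tau> (U (n+1)) (Q (n+1)) (Uh (n+1))) (\<lambda>K E.
      Uh_diff n)
    + 1/2 * interior_bd_pair \<Omega> T (num_flux \<tau> (U (n-1)) (Q (n-1)) (Uh (n-1))) (\<lambda>K E. Uh_diff n)"
    unfolding interior_bd_pair_def by (simp only: sum.distrib sum_distrib_left)
  finally show ?thesis using zero by simp
qed

lemma jump_norm_sq: "(plus_norm T \<tau> (U m) (Uh m))\<^sup>2 =
    (\<Sum>K\<in>T. \<Sum>E | E facet_of K. LINT x|edge_measure E. \<tau> E * (piece K (U m) x - Uh m x)\<^sup>2)"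
  by (rule plus_norm_sq[OF tau_pos])

text \<open>The pointwise form of \<open>edge_balance\<close>: \<open>q\<close> is the normal component of the averaged \<open>Q\<close>, \<open>t\<close> the
  stabilization, \<open>e\<close> and \<open>f\<close> are the jumps \<open>U - Uh\<close> at the later and the earlier level, and \<open>a\<close> is
  the averaged numerical flux.\<close>

lemma flux_jump_identity:
  fixes a q t e f d w :: real
  assumes "a = q - t * (1/2 * (e + f))" and "w = d + e - f"
  shows "a * w - w * q + d * q = a * d - 1/2 * (t * e\<^sup>2 - t * f\<^sup>2)"
  unfolding assms by (simp add: power2_eq_square field_simps)

text \<open>Collects the edge terms that the wave equation, Green's formula and the flux equation leave
  behind. The stabilization in the numerical flux multiplies the average of the jumps, and
  \<open>w - (Uh\<^sup>n\<^sup>+\<^sup>1 - Uh\<^sup>n\<^sup>-\<^sup>1)\<close> is their difference, whence the difference of squares.\<close>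

lemma edge_balance:
  "bd_pair T (avg_flux n) (\<lambda>K E. piece K (U_diff n))
     - bd_pair T (\<lambda>K E. piece K (U_diff n)) (\<lambda>K E x. piece K (Q_avg n) x \<bullet> outward_normal K E)
     + bd_pair T (\<lambda>K E. Uh_diff n) (\<lambda>K E x. piece K (Q_avg n) x \<bullet> outward_normal K E)
   = bd_pair T (avg_flux n) (\<lambda>K E. Uh_diff n)
     - 1/2 * ((plus_norm T \<tau> (U (n+1)) (Uh (n+1)))\<^sup>2 - (plus_norm T \<tau> (U (n-1)) (Uh (n-1)))\<^sup>2)"
  unfolding bd_pair_def jump_norm_sq sum_distrib_left sum_subtractf[symmetric] sum.distrib[symmetric]
proof (intro sum.cong refl)
  fix K E assume "K \<in> T" and "E \<in> {E. E facet_of K}"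
  then have KE: "K \<in> T" "E facet_of K" by auto
  let ?M = "edge_measure E" and ?q = "\<lambda>x. piece K (Q_avg n) x \<bullet> outward_normal K E"
  let ?w = "piece K (U_diff n)"
  let ?e = "\<lambda>m x. piece K (U m) x - Uh m x"
  have M: "integrates_continuous ?M" "AE x in ?M. x \<in> K" using facet_measure[OF cells KE(2)] KE by auto
  have Em: "E \<in> mesh_edges T" using facet_mesh_edge KE by blast
  have cw: "essentially_continuous ?M ?w"
    by (intro essentially_continuous_continuous continuous_on_polymonial_function
        W_space_piece(1)[OF U_diff_W KE(1)])
  have cq: "essentially_continuous ?M ?q"
    by (intro ess_cont essentially_continuous_continuous[of "piece K (Q_avg n)"]
        continuous_on_polymonial_function V_space_piece(1)[OF Q_avg_V KE(1)])
  have ch: "essentially_continuous ?M (Uh_diff n)"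
    by (rule M_space_essentially_continuous[OF Uh_diff_M Em])
  have ce: "essentially_continuous ?M (?e m)" for m
    by (intro ess_cont ess_piece_U ess_Uh Em KE)
  note cA = ess_avg_flux[OF KE, of n]
  note int = essentially_continuous_integrable[OF M(1)]
  have i1: "integrable ?M (\<lambda>x. avg_flux n K E x * ?w x)" "integrable ?M (\<lambda>x. ?w x * ?q x)"
    "integrable ?M (\<lambda>x. Uh_diff n x * ?q x)" "integrable ?M (\<lambda>x. avg_flux n K E x * Uh_diff n x)"
    by (intro int essentially_continuous_mult cA cw cq ch)+
  have i2: "integrable ?M (\<lambda>x. \<tau> E * (?e m x)\<^sup>2)" for m
    by (intro int essentially_continuous_mult essentially_continuous_power
        essentially_continuous_const ce)
  have "(LINT x|?M. avg_flux n K E x * ?w x) - (LINT x|?M. ?w x * ?q x) + (LINT x|?M. Uh_diff n x *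
      ?q x)
     = (LINT x|?M. avg_flux n K E x * ?w x - ?w x * ?q x + Uh_diff n x * ?q x)"
    using i1 by simp
  also have "\<dots> = (LINT x|?M. avg_flux n K E x * Uh_diff n x - 1/2 * (\<tau> E * (?e (n+1) x)\<^sup>2 - \<tau> E *
      (?e (n-1) x)\<^sup>2))"
  proof (rule integral_AE_eq[OF M(1)])
    show "essentially_continuous ?M (\<lambda>x. avg_flux n K E x * Uh_diff n x - 1/2 * (\<tau> E * (?e (n+1)
        x)\<^sup>2 - \<tau> E * (?e (n-1) x)\<^sup>2))"
      by (intro essentially_continuous_arith(2) essentially_continuous_mult
          essentially_continuous_power essentially_continuous_const ce cA ch)
    show "AE x in ?M. avg_flux n K E x * ?w x - ?w x * ?q x + Uh_diff n x * ?q x =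
       avg_flux n K E x * Uh_diff n x - 1/2 * (\<tau> E * (?e (n+1) x)\<^sup>2 - \<tau> E * (?e (n-1) x)\<^sup>2)"
      using M(2)
    proof eventually_elim
      case (elim x)
      have "avg_flux n K E x = ?q x - \<tau> E * (1/2 * (?e (n+1) x + ?e (n-1) x))"
        unfolding avg_flux_eq num_flux_def piece_Q_avg[OF KE(1) elim]
        by (simp add: inner_add_left algebra_simps add_divide_distrib diff_divide_distrib)
      moreover have "?w x = Uh_diff n x + ?e (n+1) x - ?e (n-1) x"
        using piece_U_diff[OF KE(1) elim, of n] by (simp add: Uh_diff_def)
      ultimately show ?case
        by (rule flux_jump_identity)
    qed
  qed
  also have "\<dots> = (LINT x|?M. avg_flux n K E x * Uh_diff n x)
      - 1/2 * ((LINT x|?M. \<tau> E * (?e (n+1) x)\<^sup>2) - (LINT x|?M. \<tau> E * (?e (n-1) x)\<^sup>2))"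
  proof -
    have "integrable ?M (\<lambda>x. 1/2 * (\<tau> E * (?e (n+1) x)\<^sup>2 - \<tau> E * (?e (n-1) x)\<^sup>2))"
      by (rule integrable_mult_right, rule Bochner_Integration.integrable_diff) (rule i2)+
    then show ?thesis
      by (simp only: Bochner_Integration.integral_diff[OF i1(4)] integral_mult_right_zero
          Bochner_Integration.integral_diff[OF i2 i2])
  qed
  finally show "(LINT x|?M. avg_flux n K E x * ?w x) - (LINT x|?M. ?w x * ?q x) + (LINT x|?M.
      Uh_diff n x * ?q x)
     = (LINT x|?M. avg_flux n K E x * Uh_diff n x)
      - 1/2 * ((LINT x|?M. \<tau> E * (?e (n+1) x)\<^sup>2) - (LINT x|?M. \<tau> E * (?e (n-1) x)\<^sup>2))" .
qed

text \<open>Both levels are tested with the same function, so only the solution is differenced.\<close>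

lemma flux_equation_difference:
  "vol_pair T (\<lambda>K. Q (n + 1)) (\<lambda>K. Q_avg n) - vol_pair T (\<lambda>K. Q (n - 1)) (\<lambda>K. Q_avg n)
    + vol_pair T (\<lambda>K. U_diff n) (\<lambda>K. divergence (piece K (Q_avg n)))
    = bd_pair T (\<lambda>K E. Uh_diff n) (\<lambda>K E x. piece K (Q_avg n) x \<bullet> outward_normal K E)"
proof -
  have eq: "vol_pair T (\<lambda>K. Q m) (\<lambda>K. Q_avg n) + vol_pair T (\<lambda>K. U m) (\<lambda>K. divergence (piece K
      (Q_avg n)))
        - bd_pair T (\<lambda>K E. Uh m) (\<lambda>K E x. piece K (Q_avg n) x \<bullet> outward_normal K E) = 0" for m
    using scheme Q_avg_V unfolding hdg_scheme_def by blast
  note pv = V_space_piece(1)[OF Q_avg_V]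
  have "vol_pair T (\<lambda>K. U_diff n) (\<lambda>K. divergence (piece K (Q_avg n))) =
    vol_pair T (\<lambda>K. U (n+1)) (\<lambda>K. divergence (piece K (Q_avg n))) -
    vol_pair T (\<lambda>K. U (n-1)) (\<lambda>K. divergence (piece K (Q_avg n)))"
    unfolding vol_pair_def sum_subtractf[symmetric]
  proof (rule sum.cong[OF refl])
    fix K assume K: "K \<in> T"
    have "integrable (lebesgue_on K) (\<lambda>x. U m x \<bullet> divergence (piece K (Q_avg n)) x)" for m
      by (intro essentially_continuous_integrable cell_measure K essentially_continuous_inner ess_U
          essentially_continuous_continuous continuous_divergence pv)
    then show "(LINT x|lebesgue_on K. U_diff n x \<bullet> divergence (piece K (Q_avg n)) x) =
       (LINT x|lebesgue_on K. U (n+1) x \<bullet> divergence (piece K (Q_avg n)) x) -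
       (LINT x|lebesgue_on K. U (n-1) x \<bullet> divergence (piece K (Q_avg n)) x)"
      unfolding U_diff_def inner_diff_left by (intro Bochner_Integration.integral_diff)
  qed
  moreover have "bd_pair T (\<lambda>K E. Uh_diff n) (\<lambda>K E x. piece K (Q_avg n) x \<bullet> outward_normal K E) =
    bd_pair T (\<lambda>K E. Uh (n+1)) (\<lambda>K E x. piece K (Q_avg n) x \<bullet> outward_normal K E) -
    bd_pair T (\<lambda>K E. Uh (n-1)) (\<lambda>K E x. piece K (Q_avg n) x \<bullet> outward_normal K E)"
    unfolding bd_pair_def sum_subtractf[symmetric]
  proof (intro sum.cong refl)
    fix K E assume "K \<in> T" and "E \<in> {E. E facet_of K}"
    then have KE: "K \<in> T" "E facet_of K" by auto
    have "integrable (edge_measure E) (\<lambda>x. Uh m x * (piece K (Q_avg n) x \<bullet> outward_normal K E))" for m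
      by (intro essentially_continuous_integrable facet_measure(1)[OF cells[OF KE(1)] KE(2)] KE
          essentially_continuous_mult
          essentially_continuous_inner essentially_continuous_const ess_Uh facet_mesh_edge[OF KE]
          essentially_continuous_continuous[of "piece K (Q_avg n)"]
              continuous_on_polymonial_function pv)
    then show "(LINT x|edge_measure E. Uh_diff n x * (piece K (Q_avg n) x \<bullet> outward_normal K E)) =
       (LINT x|edge_measure E. Uh (n+1) x * (piece K (Q_avg n) x \<bullet> outward_normal K E)) -
       (LINT x|edge_measure E. Uh (n-1) x * (piece K (Q_avg n) x \<bullet> outward_normal K E))"
      unfolding Uh_diff_def left_diff_distrib by (intro Bochner_Integration.integral_diff)
  qed
  ultimately show ?thesis using eq[of "n+1"] eq[of "n-1"] by simp
qed

text \<open>Eliminates the gradient, divergence and edge terms from the balances above. The levels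
  \<open>n + 1/2\<close> and \<open>n - 1/2\<close> share the contributions of level \<open>n\<close>, which cancel in the difference.\<close>

lemma energy_step:
  assumes n: "n \<ge> 1"
  shows "energy \<Omega> T \<tau> \<Delta>t U Q Uh n = energy \<Omega> T \<tau> \<Delta>t U Q Uh (n - 1)"
proof -
  have "vol_pair T (\<lambda>K x. dtt \<Delta>t (\<lambda>m. U m x) n) (\<lambda>K. U_diff n)
        + vol_pair T (\<lambda>K. Q_avg n) (\<lambda>K. grad (piece K (U_diff n)))
        - bd_pair T (avg_flux n) (\<lambda>K E. piece K (U_diff n))
        + vol_pair T (\<lambda>K x. F_quot (U (n + 1) x) (U (n - 1) x)) (\<lambda>K. U_diff n) = 0"
    using scheme n U_diff_W unfolding hdg_scheme_def avg_flux_def[abs_def] Q_avg_def[abs_def] by blast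
  moreover have "vol_pair T (\<lambda>K. U_diff n) (\<lambda>K. divergence (piece K (Q_avg n)))
      + vol_pair T (\<lambda>K. Q_avg n) (\<lambda>K. grad (piece K (U_diff n))) =
    bd_pair T (\<lambda>K E. piece K (U_diff n)) (\<lambda>K E x. piece K (Q_avg n) x \<bullet> outward_normal K E)"
    by (rule discrete_green[OF cells U_diff_W Q_avg_V])
  ultimately have balance:
    "(l2norm (lebesgue_on \<Omega>) (\<lambda>x. dt \<Delta>t (\<lambda>m. U m x) n))\<^sup>2
      - (l2norm (lebesgue_on \<Omega>) (\<lambda>x. dt \<Delta>t (\<lambda>m. U m x) (n - 1)))\<^sup>2
      + 1/2 * ((l2norm (lebesgue_on \<Omega>) (Q (n + 1)))\<^sup>2 - (l2norm (lebesgue_on \<Omega>) (Q (n - 1)))\<^sup>2)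
      + 1/2 * ((plus_norm T \<tau> (U (n + 1)) (Uh (n + 1)))\<^sup>2 - (plus_norm T \<tau> (U (n - 1)) (Uh (n - 1)))\<^sup>2)
      + (vol_pair T (\<lambda>K x. F_pot (U (n + 1) x)) (\<lambda>K x. 1)
        - vol_pair T (\<lambda>K x. F_pot (U (n - 1) x)) (\<lambda>K x. 1)) = 0"
    using kinetic_balance[OF n] potential_balance[of n] flux_norm_balance[of n]
      flux_equation_difference[of n] edge_balance[of n] avg_flux_Uh_diff[of n]
    by linarith
  have "n - 1 + 1 = n" using n by simp
  with balance show ?thesis
    unfolding energy_def by (simp add: field_simps)
qed

lemma energy_conserved: "energy \<Omega> T \<tau> \<Delta>t U Q Uh n = energy \<Omega> T \<tau> \<Delta>t U Q Uh 0"
proof (induction n)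
  case (Suc n)
  then show ?case using energy_step[of "Suc n"] by simp
qed simp

end

theorem theorem5p1:
  fixes \<Omega> :: "(real^2) set" and T :: "(real^2) set set" and k n :: nat
    and \<tau> :: "(real^2) set \<Rightarrow> real" and \<sigma> \<Delta>t :: real
    and U :: "nat \<Rightarrow> real^2 \<Rightarrow> real" and Q :: "nat \<Rightarrow> real^2 \<Rightarrow> real^2"
    and Uh :: "nat \<Rightarrow> real^2 \<Rightarrow> real"
  assumes "convex_polygonal_domain \<Omega>"
    and "triangulation_of T \<Omega>" and "shape_regular \<sigma> T"
    and "\<And>E. E \<in> mesh_edges T \<Longrightarrow> \<tau> E > 0"
    and "\<Delta>t > 0"
    and "\<And>m. U m \<in> W_space \<Omega> T k"
    and "\<And>m. Q m \<in> V_space \<Omega> T k"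
    and "\<And>m. Uh m \<in> M_space T k"
    and "hdg_scheme \<Omega> T k \<tau> \<Delta>t U Q Uh"
    and "n \<ge> 1"
  shows "energy \<Omega> T \<tau> \<Delta>t U Q Uh n = energy \<Omega> T \<tau> \<Delta>t U Q Uh 1"
proof -
  interpret hdg_solution \<Omega> T k \<tau> \<Delta>t U Q Uh
    using assms(1,2,4-9) by (rule hdg_solution.intro)
  \<comment> \<open>Both energies equal the one at the time level \<open>1/2\<close>.\<close>
  show ?thesis
    using energy_conserved[of n] energy_conserved[of 1] by simp
qed

end
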